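(* For each $n$ for which a self-conjugate partition of $n$ exists, let $\lambda^{(n)}\in P(n)$ be a self-conjugate partition of $n$. Then $$\lim_{n\to+\infty}\frac{|C(\lambda^{(n)})|}{|P(n)|}=0 .$$ In particular, for the staircase partitions $\rho_m=(m,m-1,\ldots,1)$, $$\lim_{m\to+\infty}\frac{|C(\rho_m)|}{\left|P\left(\frac{m(m+1)}{2}\right)\right|}=0 .$$
   Context: $P(n)$ is the set of partitions of $n$. A partition is self-conjugate if it equals its conjugate (transpose) $\lambda'$. For $\lambda,\mu\in P(n)$, $\lambda$ dominates $\mu$ (written $\lambda\unrhd\mu$) if $\sum_{i=1}^k\lambda_i\ge\sum_{i=1}^k\mu_i$ for all $k$; $\lambda$ and $\mu$ are comparable if $\lambda\unrhd\mu$ or $\mu\unrhd\lambda$. $C(\lambda)\subseteq P(n)$ is the set of partitions of $n$ comparable to $\lambda$ in the dominance order. *)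

theory Defs
  imports Complex_Main
begin

text \<open>
  A partition \<open>\<lambda>\<^sub>1 \<ge> \<lambda>\<^sub>2 \<ge> \<dots>\<close> is represented by the weakly decreasing, eventually zero
  sequence of its parts, padded with zeros. Indices start at \<open>0\<close>, so \<open>p i\<close> is the part
  \<open>\<lambda>\<^sub>i\<^sub>+\<^sub>1\<close>; different partitions are different functions.
\<close>

definition partitions_of :: "nat \<Rightarrow> (nat \<Rightarrow> nat) set" where
  "partitions_of n =
     {p. antimono p \<and> finite {i. p i \<noteq> 0} \<and> (\<Sum>i | p i \<noteq> 0. p i) = n}"

text \<open>
  The \<open>j\<close>-th part of the conjugate is the length of the \<open>j\<close>-th column of the Young diagram,
  i.e. \<open>\<lambda>'\<^sub>j = |{i. \<lambda>\<^sub>i \<ge> j}|\<close>; the strict inequality below comes from starting at \<open>0\<close>.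
\<close>

definition conjugate_partition :: "(nat \<Rightarrow> nat) \<Rightarrow> nat \<Rightarrow> nat" where
  "conjugate_partition p j = card {i. j < p i}"

definition self_conjugate :: "(nat \<Rightarrow> nat) \<Rightarrow> bool" where
  "self_conjugate p \<longleftrightarrow> conjugate_partition p = p"

definition dominates :: "(nat \<Rightarrow> nat) \<Rightarrow> (nat \<Rightarrow> nat) \<Rightarrow> bool" where
  "dominates p q \<longleftrightarrow> (\<forall>k. (\<Sum>i<k. q i) \<le> (\<Sum>i<k. p i))"

definition dominance_comparable :: "(nat \<Rightarrow> nat) \<Rightarrow> (nat \<Rightarrow> nat) \<Rightarrow> bool" where
  "dominance_comparable p q \<longleftrightarrow> dominates p q \<or> dominates q p"

definition comparable_partitions :: "nat \<Rightarrow> (nat \<Rightarrow> nat) \<Rightarrow> (nat \<Rightarrow> nat) set" where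
  "comparable_partitions n p = {q \<in> partitions_of n. dominance_comparable p q}"

text \<open>\<open>(m, m - 1, \<dots>, 1, 0, 0, \<dots>)\<close>; the zeros arise from truncated subtraction.\<close>

definition staircase :: "nat \<Rightarrow> nat \<Rightarrow> nat" where
  "staircase m i = m - i"

lemma finite_partitions_of: "finite (partitions_of n)"
proof (rule finite_subset)
  show "finite {p. \<forall>i. (i \<in> {..<n} \<longrightarrow> p i \<in> {..n}) \<and> (i \<notin> {..<n} \<longrightarrow> p i = (0::nat))}"
    by (rule finite_set_of_finite_funs) auto
next
  have "p i \<le> n" "i \<ge> n \<Longrightarrow> p i = 0" if "p \<in> partitions_of n" for p i
  proof -
    from that have dec: "antimono p" and fin: "finite {i. p i \<noteq> 0}"
      and n: "(\<Sum>i | p i \<noteq> 0. p i) = n"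
      by (auto simp: partitions_of_def)
    show "p i \<le> n"
      using member_le_sum[of i "{i. p i \<noteq> 0}" p] fin n by (cases "p i = 0") auto
    show "p i = 0" if "i \<ge> n"
    proof (rule ccontr)
      assume nz: "p i \<noteq> 0"
      have pos: "p j \<noteq> 0" if "j \<le> i" for j
        using antimonoD[OF dec that] nz by simp
      have "Suc i = (\<Sum>j\<le>i. 1)" by simp
      also have "\<dots> \<le> (\<Sum>j\<le>i. p j)"
        using pos by (intro sum_mono) (simp add: Suc_le_eq)
      also have "\<dots> \<le> (\<Sum>j | p j \<noteq> 0. p j)"
        using pos fin by (intro sum_mono2) auto
      finally show False using n that by simp
    qed
  qed
  then show "partitions_of n \<subseteq>
      {p. \<forall>i. (i \<in> {..<n} \<longrightarrow> p i \<in> {..n}) \<and> (i \<notin> {..<n} \<longrightarrow> p i = 0)}"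
    by auto
qed

lemma staircase_partition: "staircase m \<in> partitions_of (m * (m + 1) div 2)"
proof -
  have supp: "{i. staircase m i \<noteq> 0} = {..<m}"
    by (auto simp: staircase_def)
  have "2 * (\<Sum>i<m. m - i) = m * (m + 1)"
  proof (induction m)
    case (Suc m)
    have "(\<Sum>i<Suc m. Suc m - i) = Suc m + (\<Sum>i<m. m - i)"
      by (subst sum.lessThan_Suc_shift) simp
    with Suc show ?case by simp
  qed simp
  then have "(\<Sum>i<m. m - i) = m * (m + 1) div 2" by simp
  then have "(\<Sum>i | staircase m i \<noteq> 0. staircase m i) = m * (m + 1) div 2"
    unfolding supp by (simp only: staircase_def)
  moreover have "antimono (staircase m)"
    by (rule antimonoI) (simp add: staircase_def diff_le_mono2)
  moreover have "finite {i. staircase m i \<noteq> 0}"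
    unfolding supp by (rule finite_lessThan)
  ultimately show ?thesis unfolding partitions_of_def by blast
qed

lemma staircase_self_conjugate: "self_conjugate (staircase m)"
proof -
  have "{i. j < m - i} = {..<m - j}" for j :: nat by auto
  then show ?thesis
    by (auto simp: self_conjugate_def conjugate_partition_def staircase_def fun_eq_iff)
qed

end

theory Submission
  imports Defs "HOL-Analysis.Convex"
begin

text \<open>
  Conjugation reverses dominance. If \<open>\<lambda>\<close> is self-conjugate and \<open>\<mu>\<close> dominates \<open>\<lambda>\<close>, then
  \<open>\<lambda> = \<lambda>'\<close> dominates \<open>\<mu>'\<close>, so \<open>\<mu>\<close> dominates its own conjugate; symmetrically, if \<open>\<lambda>\<close> dominates
  \<open>\<mu>\<close>, then \<open>\<mu>'\<close> dominates \<open>\<mu>\<close>. The given \<open>\<lambda>\<close> thus disappears from the problem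
  (\<open>comparable_self_conjugate\<close>), and it remains to see that a uniformly random partition of \<open>n\<close>
  dominates its conjugate with probability tending to \<open>0\<close>.

  Cut a partition along its Durfee square of side \<open>D\<close>. The part to the right of the square has
  \<open>a\<^sub>j\<close> columns of height \<open>j\<close>, the part below has \<open>b\<^sub>j\<close> rows of length \<open>j\<close> (\<open>1 \<le> j \<le> D\<close>), and the
  only constraint is \<open>D\<^sup>2 + \<Sum> j (a\<^sub>j + b\<^sub>j) = n\<close>. Exchanging \<open>a\<^sub>j\<close> and \<open>b\<^sub>j\<close> for an arbitrary set of
  indices \<open>j\<close> preserves it. Hence the imbalances \<open>x\<^sub>j = a\<^sub>j - b\<^sub>j\<close> carry independent fair random signs,
  while for \<open>k \<le> D\<close> the difference of the \<open>k\<close>-th partial sums of \<open>\<mu>\<close> and \<open>\<mu>'\<close> is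
  \<open>S\<^sub>k = \<Sum> min j k x\<^sub>j\<close>. So dominance means that a family of signed sums is nonnegative throughout.

  Typically \<open>j x\<^sub>j\<close> is of order \<open>sqrt n\<close> for every fixed \<open>j\<close>. Then the variance of \<open>S\<^sub>k\<close> over the signs
  is of order \<open>n k\<close>, and all but a fraction of order \<open>1/R\<close> of it comes from the indices between
  \<open>k/R\<close> and \<open>k R\<close>. For \<open>k = R, R\<^sup>3, R\<^sup>5, \<dots>\<close> these blocks are disjoint, so the main terms of the
  corresponding \<open>S\<^sub>k\<close> are independent; each is substantially negative with probability bounded below
  by the second and fourth moments (\<open>signed_sum_often_negative\<close>). The probability that the first
  \<open>r\<close> of these \<open>S\<^sub>k\<close> are all nonnegative is therefore at most about \<open>(29/32)\<^sup>r\<close>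
  (\<open>signed_sums_rarely_all_nonneg\<close>), and \<open>r\<close> is arbitrary.

  What has to be known about the partition numbers \<open>p(n)\<close> are two regularity properties on the
  scale \<open>sqrt n\<close>. They come from one device: inserting \<open>t\<close> columns of height \<open>j\<close> is a bijection from
  the partitions of \<open>n - j t\<close> to the partitions of \<open>n\<close> with at least \<open>t\<close> columns of height \<open>j\<close>.
  Since a partition has at most \<open>sqrt (2 n)\<close> different column heights, \<open>p(n - H) \<le> p(n) / 2\<close> for
  \<open>H\<close> of order \<open>sqrt n\<close> (\<open>pnum_halves\<close>), which bounds the second moments of the column
  multiplicities and hence of the \<open>x\<^sub>j\<close>. Conversely \<open>p(n - m)\<close> is close to \<open>p(n)\<close> for small
  \<open>m / sqrt n\<close> (\<open>pnum_continuity\<close>), which shows that the multiplicities, and hence the \<open>x\<^sub>j\<close>,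
  are rarely small.

  Below, indices start at \<open>0\<close>, so index \<open>j\<close> refers to columns of height \<open>Suc j\<close>.
\<close>

section \<open>Partitions by column multiplicities\<close>

lemma partitions_of_iff:
  "p \<in> partitions_of n \<longleftrightarrow> antimono p \<and> (\<exists>N. (\<forall>i\<ge>N. p i = 0) \<and> (\<Sum>i<N. p i) = n)"
proof
  assume "p \<in> partitions_of n"
  then have p: "antimono p" "finite {i. p i \<noteq> 0}" "(\<Sum>i | p i \<noteq> 0. p i) = n"
    unfolding partitions_of_def by blast+
  obtain N where N: "\<And>i. p i \<noteq> 0 \<Longrightarrow> i < N"
    using p(2) unfolding finite_nat_set_iff_bounded by blast
  have "(\<Sum>i<N. p i) = (\<Sum>i | p i \<noteq> 0. p i)"
    by (rule sum.mono_neutral_right) (use N in auto)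
  with p N show "antimono p \<and> (\<exists>N. (\<forall>i\<ge>N. p i = 0) \<and> (\<Sum>i<N. p i) = n)"
    by (metis leD)
next
  assume "antimono p \<and> (\<exists>N. (\<forall>i\<ge>N. p i = 0) \<and> (\<Sum>i<N. p i) = n)"
  then obtain N where p: "antimono p" "\<forall>i\<ge>N. p i = 0" "(\<Sum>i<N. p i) = n" by blast
  have sub: "{i. p i \<noteq> 0} \<subseteq> {..<N}" using p(2) by (metis (mono_tags, lifting) lessThan_iff mem_Collect_eq not_le subsetI)
  have "(\<Sum>i<N. p i) = (\<Sum>i | p i \<noteq> 0. p i)"
    by (rule sum.mono_neutral_right) (use sub in auto)
  then show "p \<in> partitions_of n"
    unfolding partitions_of_def using p finite_subset[OF sub] by simp
qed

lemma partition_antimono: "p \<in> partitions_of n \<Longrightarrow> i \<le> j \<Longrightarrow> p j \<le> p i"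
  unfolding partitions_of_iff using antimonoD by blast

lemma partition_zero_beyond:
  assumes "p \<in> partitions_of n" "n \<le> i"
  shows "p i = 0"
proof (rule ccontr)
  assume nz: "p i \<noteq> 0"
  obtain N where N: "\<forall>i\<ge>N. p i = 0" "(\<Sum>i<N. p i) = n"
    using assms by (auto simp: partitions_of_iff)
  have pos: "0 < p j" if "j \<le> i" for j
    using partition_antimono[OF assms(1) that] nz by simp
  have "Suc i = (\<Sum>j\<le>i. 1)" by simp
  also have "\<dots> \<le> (\<Sum>j\<le>i. p j)"
    using pos by (intro sum_mono) (simp add: Suc_le_eq)
  also have "\<dots> \<le> (\<Sum>j<N. p j)"
    using N(1) pos by (intro sum_mono2) (auto, metis not_le less_irrefl)
  finally show False using N assms by simp
qed

lemma partition_sum: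
  assumes "p \<in> partitions_of n" "\<And>i. N \<le> i \<Longrightarrow> p i = 0"
  shows "(\<Sum>i<N. p i) = n"
proof -
  obtain M where M: "\<forall>i\<ge>M. p i = 0" "(\<Sum>i<M. p i) = n"
    using assms by (auto simp: partitions_of_iff)
  have "(\<Sum>i<N. p i) = (\<Sum>i<N+M. p i)"
    using assms by (intro sum.mono_neutral_left) auto
  also have "\<dots> = (\<Sum>i<M. p i)"
    using M by (intro sum.mono_neutral_right) auto
  finally show ?thesis using M by simp
qed

text \<open>
  The number of columns of height \<open>Suc j\<close> in the Young diagram, i.e. the multiplicity of
  \<open>Suc j\<close> as a part of the conjugate.
\<close>

definition gap :: "(nat \<Rightarrow> nat) \<Rightarrow> nat \<Rightarrow> nat" where
  "gap p j = p j - p (Suc j)"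

definition add_columns :: "nat \<Rightarrow> nat \<Rightarrow> (nat \<Rightarrow> nat) \<Rightarrow> nat \<Rightarrow> nat" where
  "add_columns j t p = (\<lambda>i. p i + (if i \<le> j then t else 0))"

lemma add_columns_partition:
  assumes "p \<in> partitions_of n"
  shows "add_columns j t p \<in> partitions_of (n + Suc j * t)"
proof -
  obtain N where N: "antimono p" "\<forall>i\<ge>N. p i = 0" "(\<Sum>i<N. p i) = n"
    using assms by (auto simp: partitions_of_iff)
  have "(\<Sum>i<N + Suc j. p i) = n"
    by (rule partition_sum[OF assms]) (use N in auto)
  moreover have "(\<Sum>i<N + Suc j. if i \<le> j then t else 0) = (\<Sum>i<Suc j. t)"
    by (rule sum.mono_neutral_cong_right) auto
  ultimately have "(\<Sum>i<N + Suc j. add_columns j t p i) = n + Suc j * t"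
    by (simp add: add_columns_def sum.distrib)
  moreover have "antimono (add_columns j t p)"
    using partition_antimono[OF assms] by (intro antimonoI) (auto simp: add_columns_def intro: add_mono trans_le_add1)
  moreover have "\<forall>i\<ge>N + Suc j. add_columns j t p i = 0"
    using N by (auto simp: add_columns_def)
  ultimately show ?thesis unfolding partitions_of_iff by blast
qed

lemma gap_add_columns:
  assumes "p \<in> partitions_of n"
  shows "gap (add_columns j t p) i = gap p i + (if i = j then t else 0)"
  using partition_antimono[OF assms, of i "Suc i"]
  by (auto simp: gap_def add_columns_def)

text \<open>
  Summation by parts.
\<close>

lemma sum_gap_upto: "(\<Sum>j<N. Suc j * gap p j) + N * p N = (\<Sum>i<N. p i)" if "antimono p"
proof (induction N)
  case (Suc N)
  have "p (Suc N) \<le> p N" using antimonoD[OF that] by simp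
  then have "Suc N * gap p N + Suc N * p (Suc N) = Suc N * p N"
    unfolding gap_def by (metis add_mult_distrib2 le_add_diff_inverse2)
  with Suc show ?case by simp
qed simp

text \<open>
  The cells of the diagram, counted column by column.
\<close>

lemma sum_gap:
  assumes "p \<in> partitions_of n"
  shows "(\<Sum>j<n. Suc j * gap p j) = n"
  using sum_gap_upto[of p n] partition_sum[OF assms, of n] partition_zero_beyond[OF assms] assms
  by (auto simp: partitions_of_iff)

lemma gap_le:
  assumes "p \<in> partitions_of n"
  shows "Suc j * gap p j \<le> n"
proof (cases "j < n")
  case True
  then have "Suc j * gap p j \<le> (\<Sum>j<n. Suc j * gap p j)"
    by (intro member_le_sum) auto
  then show ?thesis using sum_gap[OF assms] by simp
qed (use partition_zero_beyond[OF assms] in \<open>auto simp: gap_def\<close>)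

text \<open>
  Removing \<open>t\<close> columns of height \<open>Suc j\<close> is possible as soon as there are that many. This is the
  only source of information about the number of partitions: it turns statements about column
  multiplicities into statements about \<open>p(n - Suc j * t)\<close>.
\<close>

lemma bij_betw_add_columns:
  "bij_betw (add_columns j t) (partitions_of n) {q \<in> partitions_of (n + Suc j * t). t \<le> gap q j}"
proof (rule bij_betw_imageI)
  show "inj_on (add_columns j t) (partitions_of n)"
  proof (intro inj_onI ext)
    fix p q i assume "add_columns j t p = add_columns j t q"
    from fun_cong[OF this, of i] show "p i = q i" by (simp add: add_columns_def)
  qed
  show "add_columns j t ` partitions_of n = {q \<in> partitions_of (n + Suc j * t). t \<le> gap q j}"
  proof (intro equalityI subsetI)
    fix q assume "q \<in> {q \<in> partitions_of (n + Suc j * t). t \<le> gap q j}"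
    then have q: "q \<in> partitions_of (n + Suc j * t)" "t \<le> gap q j" by auto
    define p where "p i = q i - (if i \<le> j then t else 0)" for i
    have tq: "q (Suc j) + t \<le> q j" using q(2) partition_antimono[OF q(1), of j "Suc j"]
      by (auto simp: gap_def)
    have ge: "t \<le> q i" if "i \<le> j" for i
      using partition_antimono[OF q(1) that] tq by simp
    then have qp: "q = add_columns j t p" by (intro ext) (simp add: add_columns_def p_def)
    have anti: "antimono p"
    proof (rule antimonoI)
      fix x y :: nat assume "x \<le> y"
      show "p y \<le> p x"
      proof (cases "x \<le> j \<and> \<not> y \<le> j")
        case True
        then have "q y \<le> q (Suc j)" "q j \<le> q x" using partition_antimono[OF q(1)] by auto
        then show ?thesis using True tq by (auto simp: p_def)
      next
        case False
        then show ?thesis using partition_antimono[OF q(1) \<open>x \<le> y\<close>] \<open>x \<le> y\<close> by (auto simp: p_def diff_le_mono)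
      qed
    qed
    obtain N where N: "\<forall>i\<ge>N. q i = 0" using q by (auto simp: partitions_of_iff)
    have "p \<in> partitions_of (\<Sum>i<N. p i)"
      unfolding partitions_of_iff using anti N
      by (intro conjI exI[of _ N]) (auto simp: p_def)
    from add_columns_partition[OF this, of j t]
    have "q \<in> partitions_of ((\<Sum>i<N. p i) + Suc j * t)" using qp by simp
    then have "(\<Sum>i<N. p i) + Suc j * t = n + Suc j * t"
      using q(1) N by (metis partition_sum)
    then have "p \<in> partitions_of n" using \<open>p \<in> partitions_of (\<Sum>i<N. p i)\<close> by simp
    then show "q \<in> add_columns j t ` partitions_of n" using qp by blast
  qed (use add_columns_partition in \<open>auto simp: gap_add_columns simp del: mult_Suc\<close>)
qed

abbreviation pnum :: "nat \<Rightarrow> real" where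
  "pnum n \<equiv> real (card (partitions_of n))"

lemma sum_over_gap_ge:
  fixes F :: "(nat \<Rightarrow> nat) \<Rightarrow> real"
  assumes "Suc j * t \<le> n"
  shows "(\<Sum>q | q \<in> partitions_of n \<and> t \<le> gap q j. F q) =
         (\<Sum>p\<in>partitions_of (n - Suc j * t). F (add_columns j t p))"
  using sum.reindex_bij_betw[OF bij_betw_add_columns[of j t "n - Suc j * t"], of F] assms by simp

lemma no_gap_ge:
  assumes "n < Suc j * t"
  shows "{q \<in> partitions_of n. t \<le> gap q j} = {}"
proof -
  have False if "q \<in> partitions_of n" "t \<le> gap q j" for q
    using gap_le[OF that(1), of j] mult_le_mono2[OF that(2), of "Suc j"] assms by linarith
  then show ?thesis by blast
qed

lemma card_gap_ge:
  assumes "Suc j * t \<le> n"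
  shows "card {q \<in> partitions_of n. t \<le> gap q j} = card (partitions_of (n - Suc j * t))"
  using bij_betw_same_card[OF bij_betw_add_columns[of j t "n - Suc j * t"]] assms by simp

section \<open>The number of partitions on the scale of the square root\<close>

lemma sum_card_swap:
  assumes "finite X" "finite J"
  shows "(\<Sum>j\<in>J. of_nat (card {x \<in> X. R x j})) =
         (\<Sum>x\<in>X. of_nat (card {j \<in> J. R x j}) :: 'c :: semiring_1)"
proof -
  have "(\<Sum>j\<in>J. of_nat (card {x \<in> X. R x j})) = (\<Sum>j\<in>J. \<Sum>x\<in>X. if R x j then 1 else (0 :: 'c))"
    using assms by (simp add: sum.If_cases Int_def)
  also have "\<dots> = (\<Sum>x\<in>X. \<Sum>j\<in>J. if R x j then 1 else 0)" by (rule sum.swap)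
  also have "\<dots> = (\<Sum>x\<in>X. of_nat (card {j \<in> J. R x j}))"
    using assms by (simp add: sum.If_cases Int_def)
  finally show ?thesis .
qed

lemma pnum_mono:
  assumes "m \<le> n"
  shows "pnum m \<le> pnum n"
proof -
  have "card {q \<in> partitions_of n. n - m \<le> gap q 0} = card (partitions_of m)"
    using card_gap_ge[of 0 "n - m" n] assms by simp
  moreover have "card {q \<in> partitions_of n. n - m \<le> gap q 0} \<le> card (partitions_of n)"
    by (intro card_mono finite_partitions_of) auto
  ultimately show ?thesis by simp
qed

text \<open>
  The smallest possible right-hand side occurs for an initial segment of the naturals.
\<close>

lemma card_sq_le_sum_Suc:
  assumes "finite S"
  shows "card S * card S \<le> 2 * (\<Sum>j\<in>S. Suc j)"
  using assms
proof (induction S rule: finite_linorder_max_induct)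
  case (insert b S)
  have "S \<subseteq> {..<b}" using insert by auto
  then have "card S \<le> b" using card_mono[of "{..<b}" S] by simp
  moreover have "b \<notin> S" using insert by auto
  ultimately show ?case using insert by simp
qed simp

definition distinct_heights :: "nat \<Rightarrow> (nat \<Rightarrow> nat) \<Rightarrow> nat" where
  "distinct_heights n p = card {j \<in> {..<n}. 1 \<le> gap p j}"

lemma distinct_heights_le:
  assumes "p \<in> partitions_of n"
  shows "real (distinct_heights n p) \<le> sqrt (2 * n)"
proof -
  have "(\<Sum>j | j \<in> {..<n} \<and> 1 \<le> gap p j. Suc j) \<le> (\<Sum>j | j \<in> {..<n} \<and> 1 \<le> gap p j. Suc j * gap p j)"
    by (rule sum_mono) (metis (mono_tags, lifting) mem_Collect_eq mult.right_neutral mult_le_mono2)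
  also have "\<dots> \<le> (\<Sum>j<n. Suc j * gap p j)"
    by (intro sum_mono2) auto
  finally have "distinct_heights n p * distinct_heights n p \<le> 2 * n"
    using card_sq_le_sum_Suc[of "{j \<in> {..<n}. 1 \<le> gap p j}"] sum_gap[OF assms]
    unfolding distinct_heights_def by simp
  then have "(real (distinct_heights n p))\<^sup>2 \<le> 2 * n"
    by (metis of_nat_le_iff of_nat_mult power2_eq_square)
  then show ?thesis by (simp add: real_le_rsqrt)
qed

text \<open>
  The left-hand side counts pairs of a partition of \<open>n\<close> and one of its column heights, because
  \<open>p(n - Suc j)\<close> is the number of partitions of \<open>n\<close> with a column of height \<open>Suc j\<close>.
\<close>

lemma sum_pnum_le: "(\<Sum>j<n. pnum (n - Suc j)) \<le> sqrt (2 * n) * pnum n"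
proof -
  have "(\<Sum>j<n. pnum (n - Suc j)) = (\<Sum>j<n. real (card {q \<in> partitions_of n. 1 \<le> gap q j}))"
    using card_gap_ge[of _ 1 n] by (intro sum.cong) auto
  also have "\<dots> = (\<Sum>q\<in>partitions_of n. real (distinct_heights n q))"
    unfolding distinct_heights_def by (intro sum_card_swap finite_partitions_of finite_lessThan)
  also have "\<dots> \<le> (\<Sum>q\<in>partitions_of n. sqrt (2 * n))"
    by (intro sum_mono distinct_heights_le)
  finally show ?thesis by (simp add: mult.commute)
qed

lemma sqrt_le_half:
  assumes "8 * N \<le> H * H" "n \<le> N"
  shows "sqrt (2 * real n) \<le> real H / 2"
proof (rule real_le_lsqrt)
  have "8 * n \<le> H * H" using assms by linarith
  then have "8 * real n \<le> real H * real H" by (metis of_nat_le_iff of_nat_mult of_nat_numeral)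
  then show "2 * real n \<le> (real H / 2)\<^sup>2" by (simp add: power2_eq_square)
qed simp_all

text \<open>
  By monotonicity, the first \<open>H\<close> terms of the sum in \<open>sum_pnum_le\<close> are at least \<open>p(n - H)\<close>. The
  bound is stated for all \<open>n \<le> N\<close> with the same \<open>H\<close>, so that it can be iterated along \<open>n\<close>,
  \<open>n - H\<close>, and so on.
\<close>

lemma pnum_halves:
  assumes H: "8 * N \<le> H * H" "0 < H" and n: "n \<le> N" "H \<le> n"
  shows "pnum (n - H) \<le> pnum n / 2"
proof -
  have "real H * pnum (n - H) = (\<Sum>j<H. pnum (n - H))" by simp
  also have "\<dots> \<le> (\<Sum>j<H. pnum (n - Suc j))"
    by (intro sum_mono pnum_mono) auto
  also have "\<dots> \<le> (\<Sum>j<n. pnum (n - Suc j))"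
    using n by (intro sum_mono2) auto
  also have "\<dots> \<le> sqrt (2 * n) * pnum n" by (rule sum_pnum_le)
  also have "\<dots> \<le> (real H / 2) * pnum n"
    using sqrt_le_half[OF H(1) n(1)] by (intro mult_right_mono) auto
  finally show ?thesis using H(2) by simp
qed

text \<open>
  The factor \<open>3/2\<close> is less than \<open>2\<close>; together with the halving of \<open>p\<close> this makes the recursions
  below contract.
\<close>

lemma sq_shift_le: "(x + y)\<^sup>2 \<le> 3 / 2 * x\<^sup>2 + 3 * y\<^sup>2" for x y :: real
  using zero_le_power2[of "x - 2 * y"] by (simp add: power2_eq_square algebra_simps)

text \<open>
  Partitions with fewer than \<open>L\<close> columns of height \<open>Suc j\<close> contribute at most \<open>L\<^sup>2\<close> each. From
  the others remove \<open>L\<close> such columns; this leads to a partition of a number smaller by at least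
  \<open>H\<close>, of which there are at most half as many. With \<open>c\<close> for the constant, the induction
  needs \<open>1 + (3/2 c + 3) / 2 \<le> c\<close>, and \<open>c = 10\<close> is the least solution.
\<close>

lemma sum_gap_sq_le:
  assumes H: "8 * N \<le> H * H" "0 < H" and L: "H \<le> Suc j * L" and n: "n \<le> N"
  shows "(\<Sum>p\<in>partitions_of n. (real (gap p j))\<^sup>2) \<le> 10 * (real L)\<^sup>2 * pnum n"
  using n
proof (induction n rule: less_induct)
  case (less n)
  let ?P = "partitions_of n"
  have "(\<Sum>p\<in>?P. (real (gap p j))\<^sup>2) =
      (\<Sum>p | p \<in> ?P \<and> L \<le> gap p j. (real (gap p j))\<^sup>2) +
      (\<Sum>p | p \<in> ?P \<and> \<not> L \<le> gap p j. (real (gap p j))\<^sup>2)"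
    using finite_partitions_of[of n]
    by (subst sum.union_disjoint[symmetric]) (auto intro!: sum.cong)
  moreover have "(\<Sum>p | p \<in> ?P \<and> \<not> L \<le> gap p j. (real (gap p j))\<^sup>2) \<le> (real L)\<^sup>2 * pnum n"
  proof -
    have "(\<Sum>p | p \<in> ?P \<and> \<not> L \<le> gap p j. (real (gap p j))\<^sup>2) \<le> (\<Sum>p | p \<in> ?P \<and> \<not> L \<le> gap p j. (real L)\<^sup>2)"
      by (intro sum_mono power_mono) auto
    also have "\<dots> \<le> (\<Sum>p\<in>?P. (real L)\<^sup>2)"
      using finite_partitions_of[of n] by (intro sum_mono2) auto
    finally show ?thesis by (simp add: mult.commute)
  qed
  moreover have "(\<Sum>p | p \<in> ?P \<and> L \<le> gap p j. (real (gap p j))\<^sup>2) \<le> 9 * (real L)\<^sup>2 * pnum n"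
  proof (cases "Suc j * L \<le> n")
    case True
    define m where "m = n - Suc j * L"
    have "L > 0" using L H by (cases L) auto
    then have m: "m < n" "m \<le> N" using True less.prems by (auto simp: m_def)
    have "(\<Sum>p | p \<in> ?P \<and> L \<le> gap p j. (real (gap p j))\<^sup>2) =
        (\<Sum>p\<in>partitions_of m. (real (gap p j) + real L)\<^sup>2)"
      unfolding sum_over_gap_ge[OF True] m_def[symmetric]
      by (intro sum.cong) (auto simp: gap_add_columns)
    also have "\<dots> \<le> (\<Sum>p\<in>partitions_of m. 3 / 2 * (real (gap p j))\<^sup>2 + 3 * (real L)\<^sup>2)"
      by (intro sum_mono sq_shift_le)
    also have "\<dots> = 3 / 2 * (\<Sum>p\<in>partitions_of m. (real (gap p j))\<^sup>2) + 3 * (real L)\<^sup>2 * pnum m"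
      by (simp add: sum.distrib sum_distrib_left)
    also have "\<dots> \<le> 18 * (real L)\<^sup>2 * pnum m"
      using less.IH[OF m] by (simp add: mult_ac)
    also have "\<dots> \<le> 18 * (real L)\<^sup>2 * (pnum n / 2)"
    proof (intro mult_left_mono)
      have "pnum m \<le> pnum (n - H)" using L by (intro pnum_mono) (simp add: m_def)
      also have "\<dots> \<le> pnum n / 2"
        using pnum_halves[OF H less.prems] L True by simp
      finally show "pnum m \<le> pnum n / 2" .
    qed auto
    finally show ?thesis by (simp add: mult_ac)
  next
    case False
    then have "{p \<in> ?P. L \<le> gap p j} = {}" by (intro no_gap_ge) simp
    then show ?thesis by (simp only: sum.empty) simp
  qed
  ultimately show ?case by (simp add: algebra_simps)
qed

text \<open>
  The same recursion as in \<open>sum_gap_sq_le\<close>, now splitting the sum at \<open>H\<close> and shifting the upper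
  part by \<open>H\<close>.
\<close>

lemma sum_sq_pnum_le:
  assumes H: "8 * N \<le> H * H" "0 < H" and n: "n \<le> N"
  shows "(\<Sum>j<n. (real (Suc j))\<^sup>2 * pnum (n - Suc j)) \<le> 10 * real H ^ 3 * pnum n"
  using n
proof (induction n rule: less_induct)
  case (less n)
  let ?f = "\<lambda>j. (real (Suc j))\<^sup>2 * pnum (n - Suc j)"
  have first: "(\<Sum>j<min H n. ?f j) \<le> real H ^ 3 * pnum n"
  proof -
    have "(\<Sum>j<min H n. ?f j) \<le> (\<Sum>j<min H n. (real H)\<^sup>2 * pnum n)"
      by (intro sum_mono mult_mono power_mono pnum_mono) auto
    also have "\<dots> \<le> (\<Sum>j<H. (real H)\<^sup>2 * pnum n)"
      by (intro sum_mono2) auto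
    finally show ?thesis by (simp add: power3_eq_cube power2_eq_square)
  qed
  show ?case
  proof (cases "H \<le> n")
    case True
    define m where "m = n - H"
    have m: "m < n" "m \<le> N" using True H less.prems by (auto simp: m_def)
    have "(\<Sum>j\<in>{H..<n}. ?f j) = (\<Sum>i<m. (real (Suc i) + real H)\<^sup>2 * pnum (m - Suc i))"
      by (rule sum.reindex_bij_witness[of _ "\<lambda>i. i + H" "\<lambda>j. j - H"])
         (use True in \<open>auto simp: m_def of_nat_diff\<close>)
    also have "\<dots> \<le> (\<Sum>i<m. (3 / 2 * (real (Suc i))\<^sup>2 + 3 * (real H)\<^sup>2) * pnum (m - Suc i))"
      by (intro sum_mono mult_right_mono sq_shift_le) auto
    also have "\<dots> = 3 / 2 * (\<Sum>i<m. (real (Suc i))\<^sup>2 * pnum (m - Suc i))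
                   + 3 * (real H)\<^sup>2 * (\<Sum>i<m. pnum (m - Suc i))"
      by (simp add: sum.distrib sum_distrib_left algebra_simps)
    also have "\<dots> \<le> 3 / 2 * (10 * real H ^ 3 * pnum m) + 3 * (real H)\<^sup>2 * ((real H / 2) * pnum m)"
    proof (intro add_mono mult_left_mono)
      have "(\<Sum>i<m. pnum (m - Suc i)) \<le> sqrt (2 * m) * pnum m" by (rule sum_pnum_le)
      also have "\<dots> \<le> (real H / 2) * pnum m"
        using sqrt_le_half[OF H(1) m(2)] by (intro mult_right_mono) auto
      finally show "(\<Sum>i<m. pnum (m - Suc i)) \<le> (real H / 2) * pnum m" .
    qed (use less.IH[OF m] in auto)
    also have "\<dots> = 33 / 2 * real H ^ 3 * pnum m"
      by (simp add: power3_eq_cube power2_eq_square)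
    also have "\<dots> \<le> 33 / 2 * real H ^ 3 * (pnum n / 2)"
      using pnum_halves[OF H less.prems True] by (intro mult_left_mono) (auto simp: m_def)
    finally have half: "(\<Sum>j\<in>{H..<n}. ?f j) \<le> 33 / 2 * real H ^ 3 * (pnum n / 2)" .
    have second: "(\<Sum>j\<in>{H..<n}. ?f j) \<le> 9 * real H ^ 3 * pnum n"
    proof -
      have "(\<Sum>j\<in>{H..<n}. ?f j) \<le> 33 / 4 * (real H ^ 3 * pnum n)" using half by (simp only: mult.assoc times_divide_eq_right times_divide_eq_left)
      moreover have "0 \<le> real H ^ 3 * pnum n" by simp
      ultimately show ?thesis by (simp only: mult.assoc)
    qed
    have "{..<n} = {..<H} \<union> {H..<n}" using True by auto
    then have "(\<Sum>j<n. ?f j) = (\<Sum>j\<in>{..<H} \<union> {H..<n}. ?f j)" by metis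
    also have "\<dots> = (\<Sum>j<H. ?f j) + (\<Sum>j\<in>{H..<n}. ?f j)"
      by (rule sum.union_disjoint) auto
    finally show ?thesis using first second True by (simp add: min_def)
  next
    case False
    then have "min H n = n" by simp
    with first have "(\<Sum>j<n. ?f j) \<le> real H ^ 3 * pnum n" by (simp only:)
    also have "\<dots> \<le> 10 * real H ^ 3 * pnum n" by simp
    finally show ?thesis .
  qed
qed

text \<open>
  \<open>sum_gap_sq_le\<close> for the least \<open>L\<close> up to one with \<open>H \<le> Suc j * L\<close>.
\<close>

lemma gap_second_moment:
  assumes H: "8 * n \<le> H * H" "0 < H" and j: "Suc j \<le> H"
  shows "(real (Suc j))\<^sup>2 * (\<Sum>p\<in>partitions_of n. (real (gap p j))\<^sup>2) \<le> 40 * (real H)\<^sup>2 * pnum n"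
proof -
  define L where "L = H div Suc j + 1"
  have eq: "Suc j * (H div Suc j) + H mod Suc j = H" by (rule mult_div_mod_eq)
  have "H mod Suc j < Suc j" by simp
  then have L: "H \<le> Suc j * L" "Suc j * L \<le> 2 * H"
    using eq j unfolding L_def distrib_left mult_1_right by linarith+
  have "(real (Suc j))\<^sup>2 * (\<Sum>p\<in>partitions_of n. (real (gap p j))\<^sup>2)
      \<le> (real (Suc j))\<^sup>2 * (10 * (real L)\<^sup>2 * pnum n)"
    by (intro mult_left_mono sum_gap_sq_le[OF H L(1)]) auto
  also have "\<dots> = 10 * (real (Suc j * L))\<^sup>2 * pnum n"
    by (simp only: of_nat_mult power_mult_distrib mult_ac)
  also have "\<dots> \<le> 10 * (real (2 * H))\<^sup>2 * pnum n"
    using L(2) by (intro mult_right_mono mult_left_mono power_mono of_nat_mono) auto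
  finally show ?thesis by (simp add: power_mult_distrib)
qed

text \<open>
  For heights beyond \<open>H\<close> a single column is rare already; the multiplicity is estimated after
  removing one.
\<close>

lemma gap_tall_second_moment:
  assumes H: "8 * n \<le> H * H" "0 < H" and j: "H \<le> Suc j" "Suc j \<le> n"
  shows "(\<Sum>p\<in>partitions_of n. (real (gap p j))\<^sup>2) \<le> 22 * pnum (n - Suc j)"
proof -
  have "(\<Sum>p\<in>partitions_of n. (real (gap p j))\<^sup>2)
      = (\<Sum>p | p \<in> partitions_of n \<and> 1 \<le> gap p j. (real (gap p j))\<^sup>2)"
    by (rule sum.mono_neutral_right) (auto simp: finite_partitions_of Suc_le_eq)
  also have "\<dots> = (\<Sum>p\<in>partitions_of (n - Suc j). (real (gap p j) + 1)\<^sup>2)"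
    using sum_over_gap_ge[of j 1 n "\<lambda>p. (real (gap p j))\<^sup>2"] j
    by (simp, intro sum.cong) (auto simp: gap_add_columns)
  also have "\<dots> \<le> (\<Sum>p\<in>partitions_of (n - Suc j). 2 * (real (gap p j))\<^sup>2 + 2)"
  proof (rule sum_mono)
    fix p :: "nat \<Rightarrow> nat"
    show "(real (gap p j) + 1)\<^sup>2 \<le> 2 * (real (gap p j))\<^sup>2 + 2"
      using zero_le_power2[of "real (gap p j) - 1"] by (simp add: power2_eq_square algebra_simps)
  qed
  also have "\<dots> = 2 * (\<Sum>p\<in>partitions_of (n - Suc j). (real (gap p j))\<^sup>2) + 2 * pnum (n - Suc j)"
    by (simp add: sum.distrib sum_distrib_left)
  also have "\<dots> \<le> 22 * pnum (n - Suc j)"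
    using sum_gap_sq_le[OF H, of j 1 "n - Suc j"] j by simp
  finally show ?thesis .
qed

lemma total_gap_second_moment:
  assumes H: "8 * n \<le> H * H" "0 < H"
  shows "(\<Sum>p\<in>partitions_of n. \<Sum>j<n. (real (Suc j * gap p j))\<^sup>2) \<le> 260 * real H ^ 3 * pnum n"
proof -
  let ?M = "\<lambda>j. (real (Suc j))\<^sup>2 * (\<Sum>p\<in>partitions_of n. (real (gap p j))\<^sup>2)"
  have "(\<Sum>p\<in>partitions_of n. \<Sum>j<n. (real (Suc j * gap p j))\<^sup>2) = (\<Sum>j<n. ?M j)"
    by (subst sum.swap) (simp only: of_nat_mult power_mult_distrib sum_distrib_left)
  also have "\<dots> \<le> (\<Sum>j<n. (if j < H then 40 * (real H)\<^sup>2 * pnum n else 0)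
                     + 22 * ((real (Suc j))\<^sup>2 * pnum (n - Suc j)))"
  proof (rule sum_mono)
    fix j assume "j \<in> {..<n}"
    show "?M j \<le> (if j < H then 40 * (real H)\<^sup>2 * pnum n else 0) + 22 * ((real (Suc j))\<^sup>2 * pnum (n - Suc j))"
    proof (cases "j < H")
      case True
      have "0 \<le> 22 * ((real (Suc j))\<^sup>2 * pnum (n - Suc j))" by simp
      moreover have "?M j \<le> 40 * (real H)\<^sup>2 * pnum n" using gap_second_moment[OF H, of j] True by simp
      ultimately show ?thesis unfolding if_P[OF True] by linarith
    next
      case False
      then have "?M j \<le> (real (Suc j))\<^sup>2 * (22 * pnum (n - Suc j))"
        using \<open>j \<in> {..<n}\<close> by (intro mult_left_mono gap_tall_second_moment[OF H]) auto
      then show ?thesis unfolding if_not_P[OF False] by linarith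
    qed
  qed
  also have "\<dots> = (\<Sum>j<n. if j < H then 40 * (real H)\<^sup>2 * pnum n else 0)
                 + 22 * (\<Sum>j<n. (real (Suc j))\<^sup>2 * pnum (n - Suc j))"
    by (simp only: sum.distrib sum_distrib_left)
  also have "\<dots> \<le> 40 * real H ^ 3 * pnum n + 22 * (10 * real H ^ 3 * pnum n)"
  proof (intro add_mono mult_left_mono sum_sq_pnum_le[OF H])
    have "(\<Sum>j<n. if j < H then 40 * (real H)\<^sup>2 * pnum n else 0)
        = (\<Sum>j\<in>{..<n} \<inter> {..<H}. 40 * (real H)\<^sup>2 * pnum n)"
      by (simp add: sum.If_cases lessThan_def)
    also have "\<dots> \<le> (\<Sum>j<H. 40 * (real H)\<^sup>2 * pnum n)"
      by (intro sum_mono2) auto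
    finally show "(\<Sum>j<n. if j < H then 40 * (real H)\<^sup>2 * pnum n else 0) \<le> 40 * real H ^ 3 * pnum n"
      by (simp add: power3_eq_cube power2_eq_square)
  qed auto
  finally show ?thesis by (simp add: mult_ac)
qed

section \<open>Partition numbers vary slowly\<close>

text \<open>
  Cauchy-Schwarz for \<open>n = \<Sum> Suc j * gap p j\<close>, a sum with \<open>distinct_heights n p\<close> nonzero terms.
\<close>

lemma sq_le_distinct_heights_mult:
  assumes "p \<in> partitions_of n"
  shows "(real n)\<^sup>2 \<le> real (distinct_heights n p) * (\<Sum>j<n. (real (Suc j * gap p j))\<^sup>2)"
proof -
  let ?J = "{j \<in> {..<n}. 1 \<le> gap p j}"
  have "(\<Sum>j<n. Suc j * gap p j) = (\<Sum>j\<in>?J. Suc j * gap p j)"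
    by (rule sum.mono_neutral_right) (auto simp: Suc_le_eq)
  then have n: "real n = (\<Sum>j\<in>?J. 1 * real (Suc j * gap p j))"
    using sum_gap[OF assms] by (metis (no_types, lifting) mult_1 of_nat_sum sum.cong)
  have "(real n)\<^sup>2 \<le> (\<Sum>j\<in>?J. 1\<^sup>2) * (\<Sum>j\<in>?J. (real (Suc j * gap p j))\<^sup>2)"
    unfolding n by (rule Cauchy_Schwarz_ineq_sum)
  also have "\<dots> = real (distinct_heights n p) * (\<Sum>j\<in>?J. (real (Suc j * gap p j))\<^sup>2)"
    by (simp add: distinct_heights_def)
  also have "\<dots> \<le> real (distinct_heights n p) * (\<Sum>j<n. (real (Suc j * gap p j))\<^sup>2)"
    by (intro mult_left_mono sum_mono2) auto
  finally show ?thesis .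
qed

text \<open>
  Few different heights force the sum in \<open>sq_le_distinct_heights_mult\<close> to be large, which is rare
  by its mean \<open>total_gap_second_moment\<close>.
\<close>

lemma few_distinct_heights:
  assumes H: "8 * n \<le> H * H" "0 < H"
  shows "(real n)\<^sup>2 * real (card {p \<in> partitions_of n. distinct_heights n p < Q})
       \<le> 260 * real H ^ 3 * real Q * pnum n"
proof -
  let ?F = "{p \<in> partitions_of n. distinct_heights n p < Q}"
  let ?S = "\<lambda>p. \<Sum>j<n. (real (Suc j * gap p j))\<^sup>2"
  have "(real n)\<^sup>2 * real (card ?F) = (\<Sum>p\<in>?F. (real n)\<^sup>2)" by simp
  also have "\<dots> \<le> (\<Sum>p\<in>?F. real Q * ?S p)"
  proof (rule sum_mono)
    fix p assume p: "p \<in> ?F"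
    have "(real n)\<^sup>2 \<le> real (distinct_heights n p) * ?S p"
      using p by (intro sq_le_distinct_heights_mult) auto
    also have "\<dots> \<le> real Q * ?S p"
      using p by (intro mult_right_mono sum_nonneg) auto
    finally show "(real n)\<^sup>2 \<le> real Q * ?S p" .
  qed
  also have "\<dots> = real Q * (\<Sum>p\<in>?F. ?S p)" by (simp only: sum_distrib_left)
  also have "\<dots> \<le> real Q * (\<Sum>p\<in>partitions_of n. ?S p)"
    using finite_partitions_of[of n] by (intro mult_left_mono sum_mono2 sum_nonneg) auto
  also have "\<dots> \<le> real Q * (260 * real H ^ 3 * pnum n)"
    by (intro mult_left_mono total_gap_second_moment[OF H]) auto
  finally show ?thesis by (simp add: mult_ac)
qed

text \<open>
  Replace one column of height \<open>Suc j\<close> by \<open>Suc j\<close> columns of height \<open>1\<close>.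
\<close>

lemma card_small_first_gap_tall_le:
  assumes "Suc j \<le> n"
  shows "card {p \<in> partitions_of n. gap p 0 < m \<and> 1 \<le> gap p j}
       \<le> card {p \<in> partitions_of n. Suc j \<le> gap p 0 \<and> gap p 0 < Suc j + m}"
proof -
  let ?R = "{p \<in> partitions_of (n - Suc j). gap p 0 < m}"
  have inj: "inj_on (add_columns i t) ?R" for i t
    by (rule inj_on_subset[OF bij_betw_imp_inj_on[OF bij_betw_add_columns[of i t "n - Suc j"]]]) auto
  have "{p \<in> partitions_of n. gap p 0 < m \<and> 1 \<le> gap p j} \<subseteq> add_columns j 1 ` ?R"
  proof
    fix p assume p: "p \<in> {p \<in> partitions_of n. gap p 0 < m \<and> 1 \<le> gap p j}"
    then have "p \<in> add_columns j 1 ` partitions_of (n - Suc j)"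
      using bij_betw_imp_surj_on[OF bij_betw_add_columns[of j 1 "n - Suc j"]] assms by simp
    then show "p \<in> add_columns j 1 ` ?R"
      using p by (auto simp: gap_add_columns split: if_splits)
  qed
  then have "card {p \<in> partitions_of n. gap p 0 < m \<and> 1 \<le> gap p j} \<le> card (add_columns j 1 ` ?R)"
    by (intro card_mono) (auto simp: finite_partitions_of)
  also have "\<dots> = card (add_columns 0 (Suc j) ` ?R)"
    by (simp add: card_image inj)
  also have "\<dots> \<le> card {p \<in> partitions_of n. Suc j \<le> gap p 0 \<and> gap p 0 < Suc j + m}"
  proof (intro card_mono subsetI)
    fix q assume "q \<in> add_columns 0 (Suc j) ` ?R"
    then obtain p where p: "p \<in> ?R" "q = add_columns 0 (Suc j) p" by blast
    then show "q \<in> {p \<in> partitions_of n. Suc j \<le> gap p 0 \<and> gap p 0 < Suc j + m}"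
      using assms add_columns_partition[of p "n - Suc j" 0 "Suc j"] by (auto simp: gap_add_columns)
  qed (auto simp: finite_partitions_of)
  finally show ?thesis .
qed

text \<open>
  Each partition with fewer than \<open>m\<close> columns of height \<open>1\<close> admits one replacement as in
  \<open>card_small_first_gap_tall_le\<close> for each of its at least \<open>Q\<close> column heights. A result with \<open>g\<close>
  columns of height \<open>1\<close> arises for at most \<open>m\<close> heights \<open>Suc j\<close>, those with
  \<open>Suc j \<le> g < Suc j + m\<close>.
\<close>

lemma small_first_gap_many_heights:
  "real Q * real (card {p \<in> partitions_of n. gap p 0 < m \<and> Q \<le> distinct_heights n p}) \<le> real m * pnum n"
proof -
  let ?F = "{p \<in> partitions_of n. gap p 0 < m \<and> Q \<le> distinct_heights n p}"
  let ?E = "{p \<in> partitions_of n. gap p 0 < m}"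
  have fin: "finite ?E" using finite_partitions_of by simp
  have "real Q * real (card ?F) = (\<Sum>p\<in>?F. real Q)" by simp
  also have "\<dots> \<le> (\<Sum>p\<in>?F. real (distinct_heights n p))" by (intro sum_mono) auto
  also have "\<dots> \<le> (\<Sum>p\<in>?E. real (distinct_heights n p))" using fin by (intro sum_mono2) auto
  also have "\<dots> = (\<Sum>j<n. real (card {p \<in> ?E. 1 \<le> gap p j}))"
    unfolding distinct_heights_def by (rule sum_card_swap[OF fin finite_lessThan, symmetric])
  also have "\<dots> \<le> (\<Sum>j<n. real (card {p \<in> partitions_of n. Suc j \<le> gap p 0 \<and> gap p 0 < Suc j + m}))"
  proof (intro sum_mono of_nat_mono)
    fix j assume "j \<in> {..<n}"
    have "{p \<in> ?E. 1 \<le> gap p j} = {p \<in> partitions_of n. gap p 0 < m \<and> 1 \<le> gap p j}" by auto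
    then show "card {p \<in> ?E. 1 \<le> gap p j} \<le> card {p \<in> partitions_of n. Suc j \<le> gap p 0 \<and> gap p 0 < Suc j + m}"
      using card_small_first_gap_tall_le[of j n m] \<open>j \<in> {..<n}\<close> by simp
  qed
  also have "\<dots> = (\<Sum>p\<in>partitions_of n. real (card {j \<in> {..<n}. Suc j \<le> gap p 0 \<and> gap p 0 < Suc j + m}))"
    by (rule sum_card_swap[OF finite_partitions_of finite_lessThan])
  also have "\<dots> \<le> (\<Sum>p\<in>partitions_of n. real m)"
  proof (intro sum_mono of_nat_mono)
    fix p :: "nat \<Rightarrow> nat"
    have "card {j \<in> {..<n}. Suc j \<le> gap p 0 \<and> gap p 0 < Suc j + m} \<le> card {gap p 0 - m..<gap p 0}"
      by (intro card_mono) auto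
    then show "card {j \<in> {..<n}. Suc j \<le> gap p 0 \<and> gap p 0 < Suc j + m} \<le> m" by simp
  qed
  finally show ?thesis by (simp add: mult_ac)
qed

lemma card_small_gap:
  assumes "Suc j * t \<le> n"
  shows "real (card {p \<in> partitions_of n. gap p j < t}) = pnum n - pnum (n - Suc j * t)"
proof -
  have "card (partitions_of n) = card {p \<in> partitions_of n. gap p j < t} + card {p \<in> partitions_of n. t \<le> gap p j}"
    using finite_partitions_of[of n]
    by (subst card_Un_disjoint[symmetric]) (auto intro!: arg_cong[where f=card])
  then show ?thesis using card_gap_ge[OF assms] by simp
qed

text \<open>
  An integer \<open>H\<close> of order \<open>sqrt n\<close> to which \<open>pnum_halves\<close> applies.
\<close>

lemma ex_sqrt_scale:
  assumes "0 < n"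
  obtains H :: nat where "0 < H" "8 * n \<le> H * H" "H * H \<le> 16 * n"
proof
  define y where "y = sqrt (8 * real n)"
  have y2: "y * y = 8 * real n" by (simp add: y_def)
  have "2.8 \<le> y" unfolding y_def using assms by (intro real_le_rsqrt) (simp add: power2_eq_square)
  define H where "H = nat \<lceil>y\<rceil>"
  have H: "y \<le> real H" "real H \<le> y + 1" using \<open>2.8 \<le> y\<close> unfolding H_def by linarith+
  show "0 < H" using H \<open>2.8 \<le> y\<close> by (cases H) auto
  have "y * y \<le> real H * real H" using H \<open>2.8 \<le> y\<close> by (intro mult_mono) auto
  then have "real (8 * n) \<le> real (H * H)" using y2 by simp
  then show "8 * n \<le> H * H" by (simp only: of_nat_le_iff)
  have "real H * real H \<le> (y + 1) * (y + 1)" using H \<open>2.8 \<le> y\<close> by (intro mult_mono) auto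
  also have "\<dots> \<le> 2 * (y * y)"
  proof -
    have "1.8 * 1.8 \<le> (y - 1) * (y - 1)" using \<open>2.8 \<le> y\<close> by (intro mult_mono) auto
    then show ?thesis by (simp add: algebra_simps)
  qed
  finally have "real (H * H) \<le> real (16 * n)" using y2 by simp
  then show "H * H \<le> 16 * n" by (simp only: of_nat_le_iff)
qed

text \<open>
  The left-hand side counts the partitions with fewer than \<open>m\<close> columns of height \<open>1\<close>. The first
  summand accounts for those with fewer than \<open>Q\<close> column heights, the second one for the others.
\<close>

lemma pnum_decrement_bound:
  assumes "0 < n" "m \<le> n" "0 < Q"
  shows "pnum n - pnum (n - m) \<le> (16640 * (real Q / sqrt (real n)) + real m / real Q) * pnum n"
proof -
  obtain H where H: "0 < H" "8 * n \<le> H * H" "H * H \<le> 16 * n"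
    using ex_sqrt_scale[OF assms(1)] by blast
  define s where "s = sqrt (real n)"
  have s: "0 < s" "s * s = real n" using assms by (auto simp: s_def)
  have "(real H)\<^sup>2 \<le> (4 * s)\<^sup>2"
    using H(3) s(2) by (simp add: power2_eq_square) (metis of_nat_le_iff of_nat_mult of_nat_numeral)
  then have "real H \<le> 4 * s" using s(1) by (intro power2_le_imp_le[of "real H" "4 * s"]) auto
  then have H3: "real H ^ 3 \<le> (4 * s) ^ 3" by (intro power_mono) auto
  let ?F = "{p \<in> partitions_of n. distinct_heights n p < Q}"
  let ?M = "{p \<in> partitions_of n. gap p 0 < m \<and> Q \<le> distinct_heights n p}"
  have fin: "finite ?F" "finite ?M" using finite_partitions_of by auto
  have "(real n)\<^sup>2 * real (card ?F) \<le> 260 * real H ^ 3 * real Q * pnum n"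
    by (rule few_distinct_heights[OF H(2,1)])
  also have "\<dots> \<le> 260 * (4 * s) ^ 3 * real Q * pnum n"
    using H3 by (intro mult_right_mono mult_left_mono) auto
  also have "\<dots> = (real n)\<^sup>2 * (16640 * (real Q / s) * pnum n)"
    using s by (simp add: field_simps power2_eq_square power3_eq_cube flip: s(2))
  finally have scaled: "(real n)\<^sup>2 * real (card ?F) \<le> (real n)\<^sup>2 * (16640 * (real Q / s) * pnum n)" .
  have F: "real (card ?F) \<le> 16640 * (real Q / s) * pnum n"
    by (rule mult_left_le_imp_le[OF scaled]) (use assms(1) in simp)
  have M: "real (card ?M) \<le> real m / real Q * pnum n"
    using small_first_gap_many_heights[of Q n m] assms(3) by (simp add: field_simps)
  have "pnum n - pnum (n - m) = real (card {p \<in> partitions_of n. gap p 0 < m})"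
    using card_small_gap[of 0 m n] assms(2) by simp
  also have "\<dots> \<le> real (card (?F \<union> ?M))"
    using fin by (intro of_nat_mono card_mono) auto
  also have "\<dots> \<le> real (card ?F) + real (card ?M)"
    using card_Un_le[of ?F ?M] by (simp flip: of_nat_add)
  finally show ?thesis using F M unfolding s_def by (simp add: algebra_simps)
qed

text \<open>
  \<open>pnum_decrement_bound\<close> with \<open>Q\<close> a small multiple of \<open>sqrt n\<close>, and \<open>m\<close> a small multiple of
  that \<open>Q\<close>.
\<close>

lemma pnum_continuity:
  assumes "0 < e"
  obtains d n0 where "0 < d" "d \<le> 1"
    "\<And>n m. n0 \<le> n \<Longrightarrow> real m \<le> d * sqrt (real n) \<Longrightarrow> m \<le> n \<and> pnum n - pnum (n - m) \<le> e * pnum n"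
proof -
  \<comment> \<open>\<open>66560 = 4 * 16640\<close>; \<open>Q\<close> is at most \<open>2 * k * sqrt n\<close> after rounding up.\<close>
  define k where "k = e / 66560"
  have k: "0 < k" using assms by (simp add: k_def)
  define d where "d = min 1 (k * e / 2)"
  have d: "0 < d" "d \<le> 1" "d \<le> k * e / 2" using k assms by (auto simp: d_def)
  define n0 where "n0 = Suc (nat \<lceil>(1 / k)\<^sup>2\<rceil>)"
  show thesis
  proof (rule that[OF d(1,2)])
    fix n m assume n: "n0 \<le> n" and m: "real m \<le> d * sqrt (real n)"
    have n1: "1 \<le> n" "(1 / k)\<^sup>2 \<le> real n" using n by (auto simp: n0_def) linarith
    define s where "s = sqrt (real n)"
    have s: "1 \<le> s" "s * s = real n" using n1 by (auto simp: s_def)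
    have ks: "1 \<le> k * s" using real_le_rsqrt[OF n1(2)] k by (simp add: s_def field_simps)
    define Q where "Q = nat \<lceil>k * s\<rceil>"
    have Q: "k * s \<le> real Q" "real Q \<le> 2 * (k * s)" using ks unfolding Q_def by linarith+
    have "Q > 0" using Q ks by (cases Q) auto
    have "real m \<le> s" using m d s(1) mult_right_mono[of d 1 s] unfolding s_def by linarith
    also have "s \<le> s * s" using s(1) by simp
    finally have mn: "m \<le> n" using s(2) by simp
    have "16640 * (real Q / s) \<le> 16640 * (2 * k)"
      using Q s(1) by (simp add: field_simps)
    moreover have "real m / real Q \<le> e / 2"
    proof -
      have "real m \<le> d * s" using m by (simp add: s_def)
      also have "\<dots> \<le> k * e / 2 * s" using d s by (intro mult_right_mono) auto
      also have "\<dots> = e / 2 * (k * s)" by simp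
      also have "\<dots> \<le> e / 2 * real Q" using Q assms by (intro mult_left_mono) auto
      finally show ?thesis using \<open>Q > 0\<close> by (simp add: field_simps)
    qed
    ultimately have "16640 * (real Q / s) + real m / real Q \<le> e"
      unfolding k_def by linarith
    then have "(16640 * (real Q / s) + real m / real Q) * pnum n \<le> e * pnum n"
      by (intro mult_right_mono) auto
    then show "m \<le> n \<and> pnum n - pnum (n - m) \<le> e * pnum n"
      using mn pnum_decrement_bound[of n m Q] n1 \<open>Q > 0\<close> unfolding s_def by simp
  qed
qed

section \<open>Dominance, conjugation and the Durfee square\<close>

lemma initial_segment:
  fixes S :: "nat set"
  assumes "finite S" "\<And>x y. x \<in> S \<Longrightarrow> y \<le> x \<Longrightarrow> y \<in> S"
  shows "S = {..<card S}"
proof (cases "S = {}")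
  case False
  have "S = {..Max S}"
  proof (intro equalityI subsetI)
    fix y assume "y \<in> {..Max S}"
    then show "y \<in> S" using assms(2)[OF Max_in[OF assms(1) False]] by simp
  qed (use assms(1) in auto)
  then obtain m where m: "S = {..m}" by blast
  show ?thesis unfolding m by (simp add: lessThan_Suc_atMost)
qed simp

lemma conjugate_set:
  assumes "p \<in> partitions_of n"
  shows "{i. l < p i} = {..<conjugate_partition p l}"
  unfolding conjugate_partition_def
proof (rule initial_segment)
  show "finite {i. l < p i}"
  proof (rule finite_subset)
    show "{i. l < p i} \<subseteq> {..<n}" using partition_zero_beyond[OF assms]
      by (metis (mono_tags, lifting) lessThan_iff mem_Collect_eq not_le not_less_zero subsetI)
  qed simp
qed (use partition_antimono[OF assms] in \<open>auto intro: less_le_trans\<close>)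

lemma less_conjugate_iff:
  assumes "p \<in> partitions_of n"
  shows "i < conjugate_partition p l \<longleftrightarrow> l < p i"
  using conjugate_set[OF assms, of l] by blast

lemma conjugate_le:
  assumes "p \<in> partitions_of n"
  shows "conjugate_partition p l \<le> n"
  using less_conjugate_iff[OF assms, of n l] partition_zero_beyond[OF assms, of n] by simp

lemma sum_conjugate:
  assumes "p \<in> partitions_of n"
  shows "(\<Sum>j<k. conjugate_partition p j) = (\<Sum>i<n. min (p i) k)"
proof -
  have "(\<Sum>j<k. conjugate_partition p j) = (\<Sum>j<k. of_nat (card {i \<in> {..<n}. j < p i}))"
  proof (rule sum.cong)
    fix j
    have "{i. j < p i} \<subseteq> {..<n}"
      unfolding conjugate_set[OF assms] using conjugate_le[OF assms, of j] by simp
    then have "{i. j < p i} = {i \<in> {..<n}. j < p i}" by blast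
    then show "conjugate_partition p j = of_nat (card {i \<in> {..<n}. j < p i})"
      by (simp add: conjugate_partition_def)
  qed simp
  also have "\<dots> = (\<Sum>i<n. of_nat (card {j \<in> {..<k}. j < p i}))"
    by (rule sum_card_swap) auto
  also have "\<dots> = (\<Sum>i<n. min (p i) k)"
  proof (rule sum.cong)
    fix i
    have "{j \<in> {..<k}. j < p i} = {..<min (p i) k}" by auto
    then show "of_nat (card {j \<in> {..<k}. j < p i}) = min (p i) k" by simp
  qed simp
  finally show ?thesis .
qed

text \<open>
  The first \<open>k\<close> columns contain \<open>\<Sum> min (p i) k\<close> cells, so the excesses
  \<open>\<Sum> (p i - k)\<close> must be compared in the other direction. For \<open>q\<close> only the rows \<open>i < l\<close> with
  \<open>l = q'\<^sub>k\<close> have an excess, and their total excess is the \<open>l\<close>-th partial sum minus \<open>l k\<close>, to which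
  dominance applies.
\<close>

lemma dominates_conjugate:
  assumes p: "p \<in> partitions_of n" and q: "q \<in> partitions_of n" and "dominates p q"
  shows "dominates (conjugate_partition q) (conjugate_partition p)"
  unfolding dominates_def
proof
  fix k
  have split: "(\<Sum>i<n. min (r i) k) + (\<Sum>i<n. r i - k) = n" if "r \<in> partitions_of n" for r
  proof -
    have "(\<Sum>i<n. min (r i) k) + (\<Sum>i<n. r i - k) = (\<Sum>i<n. r i)"
      unfolding sum.distrib[symmetric] by (intro sum.cong) auto
    then show ?thesis using partition_sum[OF that, of n] partition_zero_beyond[OF that] by simp
  qed
  define l where "l = conjugate_partition q k"
  have l: "l \<le> n" unfolding l_def by (rule conjugate_le[OF q])
  have gt: "k < q i \<longleftrightarrow> i < l" for i
    unfolding l_def less_conjugate_iff[OF q] ..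
  have "(\<Sum>i<n. q i - k) = (\<Sum>i<l. q i - k)"
    using l gt by (intro sum.mono_neutral_right) (auto simp: not_less[symmetric])
  moreover have "(\<Sum>i<l. q i - k) + l * k = (\<Sum>i<l. q i)"
  proof -
    have "q i - k + k = q i" if "i < l" for i
      using gt[of i] that by simp
    then have "(\<Sum>i<l. q i - k) + (\<Sum>i<l. k) = (\<Sum>i<l. q i)"
      unfolding sum.distrib[symmetric] by (intro sum.cong) auto
    then show ?thesis by simp
  qed
  moreover have "(\<Sum>i<l. q i) \<le> (\<Sum>i<l. p i)"
    using assms(3) unfolding dominates_def by blast
  moreover have "(\<Sum>i<l. p i) \<le> (\<Sum>i<l. (p i - k) + k)" by (intro sum_mono) auto
  moreover have "(\<Sum>i<l. (p i - k) + k) = (\<Sum>i<l. p i - k) + l * k" by (simp add: sum.distrib)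
  moreover have "(\<Sum>i<l. p i - k) \<le> (\<Sum>i<n. p i - k)"
    using l by (intro sum_mono2) auto
  ultimately have "(\<Sum>i<n. q i - k) \<le> (\<Sum>i<n. p i - k)" by linarith
  then have "(\<Sum>i<n. min (p i) k) \<le> (\<Sum>i<n. min (q i) k)"
    using split[OF p] split[OF q] by linarith
  then show "(\<Sum>i<k. conjugate_partition p i) \<le> (\<Sum>i<k. conjugate_partition q i)"
    by (simp only: sum_conjugate[OF p] sum_conjugate[OF q])
qed

lemma comparable_self_conjugate:
  assumes "lam \<in> partitions_of n" "self_conjugate lam" "q \<in> partitions_of n" "dominance_comparable lam q"
  shows "dominates q (conjugate_partition q) \<or> dominates (conjugate_partition q) q"
proof -
  have lam: "conjugate_partition lam = lam" using assms(2) by (simp add: self_conjugate_def)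
  have trans: "dominates x z" if "dominates x y" "dominates y z" for x y z
    using that unfolding dominates_def by (meson order_trans)
  show ?thesis
    using assms(4) unfolding dominance_comparable_def
  proof
    assume d: "dominates lam q"
    show ?thesis using dominates_conjugate[OF assms(1,3) d] trans d lam by auto
  next
    assume d: "dominates q lam"
    show ?thesis using dominates_conjugate[OF assms(3,1) d] trans d lam by auto
  qed
qed

text \<open>
  Coordinates for partitions of \<open>n\<close>: the side \<open>D\<close> of the Durfee square, the number \<open>a j\<close> of columns
  of height \<open>Suc j\<close> to its right and the number \<open>b j\<close> of rows of length \<open>Suc j\<close> below it.
  Multiplicities are forced to vanish from \<open>D\<close> on so that the coordinates are unique.
\<close>

definition durfee_data :: "nat \<Rightarrow> (nat \<times> (nat \<Rightarrow> nat) \<times> (nat \<Rightarrow> nat)) set" where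
  "durfee_data n = {(D, a, b). (\<forall>j\<ge>D. a j = 0 \<and> b j = 0) \<and> D * D + (\<Sum>j<D. Suc j * (a j + b j)) = n}"

text \<open>
  The length of row \<open>i < D\<close> of the partition, and with \<open>b\<close> in place of \<open>a\<close> that of column \<open>i\<close>.
\<close>

definition arm :: "nat \<Rightarrow> (nat \<Rightarrow> nat) \<Rightarrow> nat \<Rightarrow> nat" where
  "arm D a i = D + (\<Sum>j\<in>{i..<D}. a j)"

text \<open>
  The partition with the given coordinates. Row \<open>i \<ge> D\<close> meets exactly the columns \<open>l < D\<close> that
  are longer than \<open>i\<close>.
\<close>

definition glue :: "nat \<times> (nat \<Rightarrow> nat) \<times> (nat \<Rightarrow> nat) \<Rightarrow> nat \<Rightarrow> nat" where
  "glue = (\<lambda>(D, a, b) i. if i < D then arm D a i else card {l \<in> {..<D}. i < arm D b l})"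

lemma arm_ge: "D \<le> arm D a i" by (simp add: arm_def)

lemma arm_antimono: "i \<le> j \<Longrightarrow> arm D a j \<le> arm D a i"
  unfolding arm_def by (intro add_left_mono sum_mono2) auto

lemma arm_step: "i < D \<Longrightarrow> arm D a i = a i + arm D a (Suc i)"
  unfolding arm_def by (simp add: sum.atLeast_Suc_lessThan)

text \<open>
  A column of height \<open>Suc j\<close> has \<open>min (Suc j) k\<close> cells in the first \<open>k\<close> rows.
\<close>

lemma sum_tails: "(\<Sum>l<k. \<Sum>j\<in>{l..<D}. b j) = (\<Sum>j<D. min (Suc j) k * b j)" for b :: "nat \<Rightarrow> nat"
proof (induction D)
  case (Suc D)
  have "(\<Sum>l<k. \<Sum>j\<in>{l..<Suc D}. b j) = (\<Sum>l<k. (\<Sum>j\<in>{l..<D}. b j) + (if l \<le> D then b D else 0))"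
    by (intro sum.cong) auto
  also have "\<dots> = (\<Sum>l<k. \<Sum>j\<in>{l..<D}. b j) + (\<Sum>l<k. if l \<le> D then b D else 0)"
    by (rule sum.distrib)
  also have "(\<Sum>l<k. if l \<le> D then b D else 0) = (\<Sum>l\<in>{..<min (Suc D) k}. b D)"
    by (rule sum.mono_neutral_cong_right) auto
  finally show ?case using Suc by simp
qed simp

lemma sum_arm: "k \<le> D \<Longrightarrow> (\<Sum>l<k. arm D b l) = k * D + (\<Sum>j<D. min (Suc j) k * b j)"
  unfolding arm_def sum.distrib sum_tails by simp

lemma less_card_arm_iff:
  assumes "l < D"
  shows "l < card {l \<in> {..<D}. i < arm D b l} \<longleftrightarrow> i < arm D b l"
proof -
  have "{l \<in> {..<D}. i < arm D b l} = {..<card {l \<in> {..<D}. i < arm D b l}}"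
    by (rule initial_segment) (auto intro: less_le_trans arm_antimono)
  then show ?thesis using assms by blast
qed

lemma glue_antimono: "antimono (glue (D, a, b))"
proof (rule antimonoI)
  fix i j :: nat assume ij: "i \<le> j"
  have "card {l \<in> {..<D}. j < arm D b l} \<le> card {l \<in> {..<D}. i < arm D b l}"
    using ij by (intro card_mono) auto
  moreover have "card {l \<in> {..<D}. j < arm D b l} \<le> arm D a i"
  proof -
    have "card {l \<in> {..<D}. j < arm D b l} \<le> card {..<D}" by (intro card_mono) auto
    then show ?thesis using arm_ge[of D a i] by simp
  qed
  ultimately show "glue (D, a, b) j \<le> glue (D, a, b) i"
    using arm_antimono[OF ij] ij by (auto simp: glue_def)
qed

lemma conjugate_glue:
  assumes "l < D"
  shows "conjugate_partition (glue (D, a, b)) l = arm D b l"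
proof -
  have "l < glue (D, a, b) i \<longleftrightarrow> i < arm D b l" for i
    using less_card_arm_iff[OF assms, of i b] arm_ge[of D a i] arm_ge[of D b l] assms
    by (auto simp: glue_def)
  then show ?thesis by (simp add: conjugate_partition_def lessThan_def[symmetric])
qed

lemma glue_partition: "glue (D, a, b) \<in> partitions_of (D * D + (\<Sum>j<D. Suc j * (a j + b j)))"
proof -
  define M where "M = arm D b 0"
  have DM: "D \<le> M" unfolding M_def by (rule arm_ge)
  have le: "arm D b l \<le> M" for l unfolding M_def by (rule arm_antimono) simp
  have zero: "\<forall>i\<ge>M. glue (D, a, b) i = 0"
    using DM le by (auto simp: glue_def not_less intro: order_trans)
  have D: "(\<Sum>j<D. min (Suc j) D * c j) = (\<Sum>j<D. Suc j * c j)" for c :: "nat \<Rightarrow> nat"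
    by (intro sum.cong) auto
  have "(\<Sum>i\<in>{D..<M}. card {l \<in> {..<D}. i < arm D b l}) = (\<Sum>l<D. card {i \<in> {D..<M}. i < arm D b l})"
    using sum_card_swap[of "{..<D}" "{D..<M}" "\<lambda>l i. i < arm D b l", where 'c = nat] by simp
  also have "\<dots> = (\<Sum>l<D. \<Sum>j\<in>{l..<D}. b j)"
  proof (rule sum.cong)
    fix l
    have "{i \<in> {D..<M}. i < arm D b l} = {D..<arm D b l}" using le[of l] by auto
    then show "card {i \<in> {D..<M}. i < arm D b l} = (\<Sum>j\<in>{l..<D}. b j)" by (simp add: arm_def)
  qed simp
  also have "\<dots> = (\<Sum>j<D. Suc j * b j)" by (simp only: sum_tails D)
  finally have low: "(\<Sum>i\<in>{D..<M}. glue (D, a, b) i) = (\<Sum>j<D. Suc j * b j)"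
    by (simp add: glue_def)
  have "(\<Sum>i<D. glue (D, a, b) i) = (\<Sum>i<D. arm D a i)" by (simp add: glue_def)
  then have up: "(\<Sum>i<D. glue (D, a, b) i) = D * D + (\<Sum>j<D. Suc j * a j)"
    by (simp only: sum_arm[OF order_refl] D)
  have "(\<Sum>i<M. glue (D, a, b) i) = (\<Sum>i<D. glue (D, a, b) i) + (\<Sum>i\<in>{D..<M}. glue (D, a, b) i)"
    using sum.atLeastLessThan_concat[of 0 D M "glue (D, a, b)"] DM by (simp add: lessThan_atLeast0)
  then have "(\<Sum>i<M. glue (D, a, b) i) = D * D + (\<Sum>j<D. Suc j * (a j + b j))"
    unfolding low up by (simp only: distrib_left sum.distrib add.assoc)
  then show ?thesis unfolding partitions_of_iff using glue_antimono zero by blast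
qed

text \<open>
  The diagonal cells of the diagram are those of the square, so \<open>D\<close> can be read off.
\<close>

lemma less_glue_iff: "i < glue (D, a, b) i \<longleftrightarrow> i < D"
proof -
  have "card {l \<in> {..<D}. i < arm D b l} \<le> D"
  proof -
    have "card {l \<in> {..<D}. i < arm D b l} \<le> card {..<D}" by (intro card_mono) auto
    then show ?thesis by simp
  qed
  then show ?thesis using arm_ge[of D a i] by (auto simp: glue_def)
qed

lemma arm_inject:
  assumes "\<And>i. i < D \<Longrightarrow> arm D a i = arm D a' i" "i < D"
  shows "a i = a' i"
proof -
  have "arm D a (Suc i) = arm D a' (Suc i)"
    using assms by (cases "Suc i < D") (auto simp: arm_def)
  then show ?thesis using assms arm_step[of i D a] arm_step[of i D a'] by simp
qed

lemma inj_on_glue: "inj_on glue (durfee_data n)"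
proof (rule inj_onI)
  fix x y assume x: "x \<in> durfee_data n" and y: "y \<in> durfee_data n" and eq: "glue x = glue y"
  obtain D a b where xd: "x = (D, a, b)" by (cases x)
  obtain D' a' b' where yd: "y = (D', a', b')" by (cases y)
  have "i < D \<longleftrightarrow> i < D'" for i
    using less_glue_iff[of i D a b] less_glue_iff[of i D' a' b'] eq unfolding xd yd by simp
  from this[of D] this[of D'] have DD: "D' = D" by simp
  have "arm D a i = arm D a' i" if "i < D" for i
    using fun_cong[OF eq, of i] that by (simp add: xd yd DD glue_def)
  then have a: "a i = a' i" if "i < D" for i using arm_inject that by blast
  have "arm D b i = arm D b' i" if "i < D" for i
    using conjugate_glue[OF that, of a b] conjugate_glue[OF that, of a' b'] eq by (simp add: xd yd DD)
  then have b: "b i = b' i" if "i < D" for i using arm_inject that by blast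
  have "a i = a' i \<and> b i = b' i" for i
    using a[of i] b[of i] x y by (cases "i < D") (auto simp: durfee_data_def xd yd DD)
  then show "x = y" by (auto simp: xd yd DD)
qed

lemma arm_of_differences:
  assumes "antimono f" "f D = D" "i \<le> D"
  shows "arm D (\<lambda>j. f j - f (Suc j)) i = f i"
proof -
  have "(\<Sum>j\<in>{i..<D}. f j - f (Suc j)) + f D = f i"
    using assms(3)
  proof (induction rule: inc_induct)
    case (step n)
    have "f (Suc n) \<le> f n" using antimonoD[OF assms(1)] by simp
    then show ?case using step by (simp add: sum.atLeast_Suc_lessThan)
  qed simp
  then show ?thesis using assms(2) by (simp add: arm_def)
qed

lemma partition_weight_unique:
  assumes "p \<in> partitions_of m" "p \<in> partitions_of n"
  shows "m = n"
proof -
  have "p i = 0" if "m + n \<le> i" for i using partition_zero_beyond[OF assms(1)] that by simp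
  then show ?thesis using partition_sum[OF assms(1), of "m + n"] partition_sum[OF assms(2), of "m + n"] by simp
qed

text \<open>
  With \<open>D\<close> the number of diagonal cells, the multiplicities are the differences of the rows and
  of the columns. Truncating both from below at \<open>D\<close> makes the differences at \<open>D - 1\<close> and beyond
  come out right without case distinctions.
\<close>

lemma partition_in_glue_image:
  assumes p: "p \<in> partitions_of n"
  shows "p \<in> glue ` durfee_data n"
proof -
  define D where "D = card {i. i < p i}"
  let ?q = "conjugate_partition p"
  have "{i. i < p i} = {..<D}" unfolding D_def
  proof (rule initial_segment)
    show "finite {i. i < p i}"
    proof (rule finite_subset)
      show "{i. i < p i} \<subseteq> {..<conjugate_partition p 0}"
        unfolding conjugate_set[OF p, symmetric] by auto
    qed simp
  next
    fix x y assume "x \<in> {i. i < p i}" "y \<le> x"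
    then show "y \<in> {i. i < p i}" using partition_antimono[OF p, of y x] by auto
  qed
  then have D: "i < p i \<longleftrightarrow> i < D" for i by blast
  have pD: "p D \<le> D" using D[of D] by simp
  have big: "D \<le> p i" if "i < D" for i
  proof -
    have "D - 1 < p (D - 1)" using D[of "D - 1"] that by simp
    moreover have "p (D - 1) \<le> p i" using that by (intro partition_antimono[OF p]) simp
    ultimately show ?thesis by simp
  qed
  have qD: "?q D \<le> D" using less_conjugate_iff[OF p, of D D] pD by simp
  have qbig: "D \<le> ?q i" if "i < D" for i
    using less_conjugate_iff[OF p, of "D - 1" i] big[of "D - 1"] that by simp
  have qanti: "?q j \<le> ?q i" if "i \<le> j" for i j
    using less_conjugate_iff[OF p, of "?q i" i] less_conjugate_iff[OF p, of "?q i" j] that by auto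
  define f where "f i = max D (p i)" for i
  define g where "g i = max D (?q i)" for i
  define a where "a = (\<lambda>j. f j - f (Suc j))"
  define b where "b = (\<lambda>j. g j - g (Suc j))"
  have "antimono f" unfolding f_def using partition_antimono[OF p] by (intro antimonoI max.mono) auto
  then have arma: "arm D a i = p i" if "i < D" for i
    using arm_of_differences[of f D i] pD big[OF that] that by (simp add: a_def f_def)
  have "antimono g" unfolding g_def using qanti by (intro antimonoI max.mono) auto
  then have armb: "arm D b i = ?q i" if "i < D" for i
    using arm_of_differences[of g D i] qD qbig[OF that] that by (simp add: b_def g_def)
  have glue: "glue (D, a, b) = p"
  proof
    fix i show "glue (D, a, b) i = p i"
    proof (cases "i < D")
      case False
      then have "p i \<le> D" using partition_antimono[OF p, of D i] pD by simp
      then have "i < arm D b l \<and> l < D \<longleftrightarrow> l < p i" for l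
        using armb[of l] less_conjugate_iff[OF p, of i l] by (cases "l < D") simp_all
      then have "{l \<in> {..<D}. i < arm D b l} = {..<p i}" by blast
      then show ?thesis using False by (simp add: glue_def)
    qed (simp add: glue_def arma)
  qed
  have supp: "a j = 0 \<and> b j = 0" if "D \<le> j" for j
    using that pD qD partition_antimono[OF p, of D j] partition_antimono[OF p, of D "Suc j"]
      qanti[of D j] qanti[of D "Suc j"] by (simp add: a_def b_def f_def g_def max_def)
  have "p \<in> partitions_of (D * D + (\<Sum>j<D. Suc j * (a j + b j)))"
    using glue_partition[of D a b] glue by simp
  then have "D * D + (\<Sum>j<D. Suc j * (a j + b j)) = n"
    by (rule partition_weight_unique[OF _ p])
  then have "(D, a, b) \<in> durfee_data n" using supp by (simp add: durfee_data_def)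
  then show ?thesis using glue by (metis image_eqI)
qed

lemma bij_betw_glue: "bij_betw glue (durfee_data n) (partitions_of n)"
proof (rule bij_betw_imageI[OF inj_on_glue])
  have "glue x \<in> partitions_of n" if "x \<in> durfee_data n" for x
    using that glue_partition[of "fst x" "fst (snd x)" "snd (snd x)"]
    unfolding durfee_data_def by (cases x) (simp del: mult_Suc)
  then show "glue ` durfee_data n = partitions_of n"
    using partition_in_glue_image by blast
qed

lemma card_durfee_data: "card (durfee_data n) = card (partitions_of n)"
  by (rule bij_betw_same_card[OF bij_betw_glue])

lemma finite_durfee_data: "finite (durfee_data n)"
  using bij_betw_finite[OF bij_betw_glue] finite_partitions_of by blast

section \<open>Random signs\<close>

text \<open>
  A choice of signs is represented by the set \<open>A\<close> of indices with a minus sign; a uniformly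
  random \<open>A \<in> Pow J\<close> gives independent fair signs.
\<close>

definition signed_sum :: "('a \<Rightarrow> real) \<Rightarrow> 'a set \<Rightarrow> 'a set \<Rightarrow> real" where
  "signed_sum w J A = (\<Sum>j\<in>J. if j \<in> A then - w j else w j)"

lemma sum_Pow_insert:
  fixes f :: "'a set \<Rightarrow> real"
  assumes "finite J" "x \<notin> J"
  shows "(\<Sum>A\<in>Pow (insert x J). f A) = (\<Sum>A\<in>Pow J. f A + f (insert x A))"
proof -
  have "(\<Sum>A\<in>Pow (insert x J). f A) = (\<Sum>A\<in>Pow J. f A) + (\<Sum>A\<in>insert x ` Pow J. f A)"
    unfolding Pow_insert using assms by (intro sum.union_disjoint) auto
  also have "(\<Sum>A\<in>insert x ` Pow J. f A) = (\<Sum>A\<in>Pow J. f (insert x A))"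
    using assms by (intro sum.reindex_cong[of "insert x"]) (auto simp: inj_on_def)
  finally show ?thesis by (simp add: sum.distrib)
qed

lemma signed_sum_insert:
  assumes "finite J" "x \<notin> J" "A \<subseteq> J"
  shows "signed_sum w (insert x J) A = signed_sum w J A + w x"
    "signed_sum w (insert x J) (insert x A) = signed_sum w J A - w x"
proof -
  show "signed_sum w (insert x J) A = signed_sum w J A + w x"
    using assms by (auto simp: signed_sum_def)
  have "signed_sum w J (insert x A) = signed_sum w J A"
    unfolding signed_sum_def using assms(2) by (intro sum.cong) auto
  then show "signed_sum w (insert x J) (insert x A) = signed_sum w J A - w x"
    using assms by (simp add: signed_sum_def)
qed

lemma signed_sum_second_moment:
  assumes "finite J"
  shows "(\<Sum>A\<in>Pow J. (signed_sum w J A)\<^sup>2) = 2 ^ card J * (\<Sum>j\<in>J. (w j)\<^sup>2)"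
  using assms
proof (induction J rule: finite_induct)
  case empty
  show ?case by (simp add: signed_sum_def)
next
  case (insert x J)
  have "(\<Sum>A\<in>Pow (insert x J). (signed_sum w (insert x J) A)\<^sup>2)
      = (\<Sum>A\<in>Pow J. (signed_sum w J A + w x)\<^sup>2 + (signed_sum w J A - w x)\<^sup>2)"
    unfolding sum_Pow_insert[OF insert.hyps]
    by (intro sum.cong) (simp_all add: signed_sum_insert[OF insert.hyps])
  also have "\<dots> = (\<Sum>A\<in>Pow J. 2 * (signed_sum w J A)\<^sup>2 + 2 * (w x)\<^sup>2)"
    by (intro sum.cong) (simp_all add: power2_eq_square algebra_simps)
  also have "\<dots> = 2 * (\<Sum>A\<in>Pow J. (signed_sum w J A)\<^sup>2) + 2 ^ card J * (2 * (w x)\<^sup>2)"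
    using insert.hyps by (simp add: sum.distrib sum_distrib_left card_Pow)
  also have "\<dots> = 2 ^ card (insert x J) * (\<Sum>j\<in>insert x J. (w j)\<^sup>2)"
    unfolding insert.IH using insert.hyps by (simp add: algebra_simps)
  finally show ?case .
qed

text \<open>
  Adding an independent term \<open>\<plusminus> w\<close> to a sum \<open>T\<close> of variance \<open>V\<close> changes the mean of \<open>T\<^sup>4\<close> by
  \<open>6 w\<^sup>2 V + w\<^sup>4\<close>, which is at most the increment of \<open>3 V\<^sup>2\<close>.
\<close>

lemma signed_sum_fourth_moment:
  assumes "finite J"
  shows "(\<Sum>A\<in>Pow J. (signed_sum w J A) ^ 4) \<le> 3 * 2 ^ card J * (\<Sum>j\<in>J. (w j)\<^sup>2)\<^sup>2"
  using assms
proof (induction J rule: finite_induct)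
  case empty
  show ?case by (simp add: signed_sum_def)
next
  case (insert x J)
  define V where "V = (\<Sum>j\<in>J. (w j)\<^sup>2)"
  define y where "y = (w x)\<^sup>2"
  have y: "0 \<le> y" by (simp add: y_def)
  have four: "(t + w x) ^ 4 + (t - w x) ^ 4 = 2 * t ^ 4 + 12 * y * t\<^sup>2 + 2 * y\<^sup>2" for t
    unfolding y_def by (simp add: power4_eq_xxxx power2_eq_square algebra_simps)
  have "(\<Sum>A\<in>Pow (insert x J). (signed_sum w (insert x J) A) ^ 4)
      = (\<Sum>A\<in>Pow J. (signed_sum w J A + w x) ^ 4 + (signed_sum w J A - w x) ^ 4)"
    unfolding sum_Pow_insert[OF insert.hyps]
    by (intro sum.cong) (simp_all add: signed_sum_insert[OF insert.hyps])
  also have "\<dots> = 2 * (\<Sum>A\<in>Pow J. (signed_sum w J A) ^ 4) + 12 * y * (\<Sum>A\<in>Pow J. (signed_sum w J A)\<^sup>2)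
      + 2 ^ card J * (2 * y\<^sup>2)"
    unfolding four using insert.hyps by (simp add: sum.distrib sum_distrib_left card_Pow)
  also have "\<dots> \<le> 2 * (3 * 2 ^ card J * V\<^sup>2) + 12 * y * (2 ^ card J * V) + 2 ^ card J * (6 * y\<^sup>2)"
    unfolding signed_sum_second_moment[OF insert.hyps(1)] V_def
    using insert.IH y by (intro add_mono mult_left_mono) auto
  also have "\<dots> = 3 * 2 ^ card (insert x J) * (V + y)\<^sup>2"
    using insert.hyps by (simp add: algebra_simps power2_eq_square)
  also have "V + y = (\<Sum>j\<in>insert x J. (w j)\<^sup>2)"
    using insert.hyps by (simp add: V_def y_def)
  finally show ?case .
qed

lemma signed_sum_complement: "A \<subseteq> J \<Longrightarrow> signed_sum w J (J - A) = - signed_sum w J A"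
  unfolding signed_sum_def sum_negf[symmetric] by (intro sum.cong) auto

text \<open>
  The Paley-Zygmund argument: as the fourth moment is at most three times the squared variance,
  \<open>\<bar>T\<bar> \<ge> sqrt V / 2\<close> has probability at least \<open>3/16\<close>, and by symmetry half of this falls on the
  negative side.
\<close>

lemma signed_sum_often_negative:
  assumes J: "finite J" and V: "V = (\<Sum>j\<in>J. (w j)\<^sup>2)" "0 < V"
  shows "real (card {A \<in> Pow J. - (sqrt V / 2) < signed_sum w J A}) \<le> 29 / 32 * 2 ^ card J"
proof -
  let ?T = "signed_sum w J"
  let ?L = "{A \<in> Pow J. sqrt V / 2 \<le> \<bar>?T A\<bar>}"
  let ?N = "{A \<in> Pow J. ?T A \<le> - (sqrt V / 2)}"
  let ?U = "{A \<in> Pow J. sqrt V / 2 \<le> ?T A}"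
  have fin: "finite (Pow J)" using J by simp
  have pt: "(?T A)\<^sup>2 \<le> V / 4 + (?T A) ^ 4 / (8 * V) + (if sqrt V / 2 \<le> \<bar>?T A\<bar> then 2 * V else 0)" for A
  proof (cases "sqrt V / 2 \<le> \<bar>?T A\<bar>")
    case True
    \<comment> \<open>AM-GM, with equality at \<open>T\<^sup>2 = 4 V\<close>; this choice of the balance makes the moments below add up.\<close>
    have "0 \<le> ((?T A)\<^sup>2 - 4 * V)\<^sup>2" by simp
    then have "(?T A)\<^sup>2 * (8 * V) \<le> (?T A) ^ 4 + 2 * V * (8 * V)"
      by (simp add: power4_eq_xxxx power2_eq_square algebra_simps)
    then have "(?T A)\<^sup>2 \<le> (?T A) ^ 4 / (8 * V) + 2 * V"
      using V(2) by (simp add: field_simps)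
    then show ?thesis using True V(2) by simp
  next
    case False
    then have "\<bar>?T A\<bar>\<^sup>2 \<le> (sqrt V / 2)\<^sup>2" by (intro power_mono) auto
    then have "(?T A)\<^sup>2 \<le> V / 4" using V(2) by (simp add: power_divide)
    moreover have "0 \<le> (?T A) ^ 4 / (8 * V)" using V(2) by simp
    ultimately show ?thesis unfolding if_not_P[OF False] by linarith
  qed
  have "2 ^ card J * V = (\<Sum>A\<in>Pow J. (?T A)\<^sup>2)"
    using signed_sum_second_moment[OF J] V(1) by simp
  also have "\<dots> \<le> (\<Sum>A\<in>Pow J. V / 4 + (?T A) ^ 4 / (8 * V) + (if sqrt V / 2 \<le> \<bar>?T A\<bar> then 2 * V else 0))"
    by (intro sum_mono pt)
  also have "\<dots> = 2 ^ card J * (V / 4) + (\<Sum>A\<in>Pow J. (?T A) ^ 4) / (8 * V) + real (card ?L) * (2 * V)"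
    using fin by (simp add: sum.distrib sum_divide_distrib card_Pow J sum.If_cases Int_def)
  also have "(\<Sum>A\<in>Pow J. (?T A) ^ 4) / (8 * V) \<le> (3 * 2 ^ card J * V\<^sup>2) / (8 * V)"
    using signed_sum_fourth_moment[OF J, of w] V by (intro divide_right_mono) auto
  also have "(3 * 2 ^ card J * V\<^sup>2) / (8 * V) = 2 ^ card J * (3 / 8 * V)"
    using V(2) by (simp add: field_simps power2_eq_square)
  finally have "(3 / 8 * 2 ^ card J) * V \<le> (real (card ?L) * 2) * V" by (simp add: algebra_simps)
  then have L: "3 / 8 * 2 ^ card J \<le> real (card ?L) * 2"
    by (rule mult_right_le_imp_le) (rule V(2))
  have "card ?L \<le> card (?N \<union> ?U)" using fin by (intro card_mono) auto
  also have "\<dots> \<le> card ?N + card ?U" by (rule card_Un_le)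
  also have "card ?U = card ?N"
    by (rule bij_betw_same_card[of "\<lambda>A. J - A"], rule bij_betw_byWitness[where f' = "\<lambda>A. J - A"])
       (auto simp: signed_sum_complement double_diff)
  finally have N: "3 / 32 * 2 ^ card J \<le> real (card ?N)" using L by linarith
  have "{A \<in> Pow J. - (sqrt V / 2) < ?T A} = Pow J - ?N" by auto
  moreover have "card (Pow J - ?N) = card (Pow J) - card ?N"
    using fin by (intro card_Diff_subset) auto
  moreover have "card ?N \<le> card (Pow J)" using fin by (intro card_mono) auto
  ultimately have "real (card {A \<in> Pow J. - (sqrt V / 2) < ?T A}) = 2 ^ card J - real (card ?N)"
    using J by (simp add: card_Pow of_nat_diff)
  then show ?thesis using N by linarith
qed

lemma signed_sum_Chebyshev:
  assumes J: "finite J" and "0 < s"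
  shows "real (card {A \<in> Pow J. s \<le> signed_sum w J A}) \<le> 2 ^ card J * ((\<Sum>j\<in>J. (w j)\<^sup>2) / s\<^sup>2)"
proof -
  let ?C = "{A \<in> Pow J. s \<le> signed_sum w J A}"
  have "real (card ?C) * s\<^sup>2 = (\<Sum>A\<in>?C. s\<^sup>2)" by simp
  also have "\<dots> \<le> (\<Sum>A\<in>?C. (signed_sum w J A)\<^sup>2)"
    using assms(2) by (intro sum_mono power_mono) auto
  also have "\<dots> \<le> (\<Sum>A\<in>Pow J. (signed_sum w J A)\<^sup>2)"
    using J by (intro sum_mono2) auto
  also have "\<dots> = 2 ^ card J * (\<Sum>j\<in>J. (w j)\<^sup>2)"
    by (rule signed_sum_second_moment[OF J])
  finally show ?thesis using assms(2) by (simp add: field_simps)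
qed

lemma card_Pow_independent:
  assumes "finite J" "B \<subseteq> J"
  shows "card {A \<in> Pow J. P (A - B) \<and> Q (A \<inter> B)} = card {A \<in> Pow (J - B). P A} * card {A \<in> Pow B. Q A}"
proof -
  have "bij_betw (\<lambda>A. (A - B, A \<inter> B)) {A \<in> Pow J. P (A - B) \<and> Q (A \<inter> B)}
      ({A \<in> Pow (J - B). P A} \<times> {A \<in> Pow B. Q A})"
  proof (rule bij_betw_byWitness[where f' = "\<lambda>(X, Y). X \<union> Y"])
    have *: "X \<union> Y - B = X" "(X \<union> Y) \<inter> B = Y" if "X \<subseteq> J - B" "Y \<subseteq> B" for X Y using that by auto
    show "\<forall>a\<in>{A \<in> Pow (J - B). P A} \<times> {A \<in> Pow B. Q A}. (\<lambda>A. (A - B, A \<inter> B)) (case a of (X, Y) \<Rightarrow> X \<union> Y) = a"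
      using * by auto
    show "(\<lambda>(X, Y). X \<union> Y) ` ({A \<in> Pow (J - B). P A} \<times> {A \<in> Pow B. Q A}) \<subseteq> {A \<in> Pow J. P (A - B) \<and> Q (A \<inter> B)}"
      using * assms(2) by auto
  qed auto
  then show ?thesis by (simp add: bij_betw_same_card card_cartesian_product)
qed

text \<open>
  Signs in disjoint blocks are independent.
\<close>

lemma card_Pow_blocks_le:
  assumes "finite J" "\<And>i. i < r \<Longrightarrow> B i \<subseteq> J" "\<And>i k. i < k \<Longrightarrow> k < r \<Longrightarrow> B i \<inter> B k = {}"
    and "\<And>i. i < r \<Longrightarrow> real (card {A \<in> Pow (B i). P i A}) \<le> c * 2 ^ card (B i)" "0 \<le> c"
  shows "real (card {A \<in> Pow J. \<forall>i<r. P i (A \<inter> B i)}) \<le> c ^ r * 2 ^ card J"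
  using assms
proof (induction r arbitrary: J)
  case 0
  have "{A \<in> Pow J. \<forall>i<0. P i (A \<inter> B i)} = Pow J" by auto
  then show ?case using card_Pow[OF 0(1)] by simp
next
  case (Suc r)
  let ?J = "J - B r"
  have Br: "B r \<subseteq> J" using Suc.prems(2) by simp
  have restrict: "(A - B r) \<inter> B i = A \<inter> B i" if "i < r" for i A
    using Suc.prems(3)[OF that] by auto
  have "{A \<in> Pow J. \<forall>i<Suc r. P i (A \<inter> B i)}
      = {A \<in> Pow J. (\<forall>i<r. P i ((A - B r) \<inter> B i)) \<and> P r (A \<inter> B r)}"
    by (auto simp: less_Suc_eq restrict)
  then have "card {A \<in> Pow J. \<forall>i<Suc r. P i (A \<inter> B i)}
      = card {A \<in> Pow ?J. \<forall>i<r. P i (A \<inter> B i)} * card {A \<in> Pow (B r). P r A}"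
    using card_Pow_independent[OF Suc.prems(1) Br, of "\<lambda>A. \<forall>i<r. P i (A \<inter> B i)" "P r"] by simp
  then have "real (card {A \<in> Pow J. \<forall>i<Suc r. P i (A \<inter> B i)})
      = real (card {A \<in> Pow ?J. \<forall>i<r. P i (A \<inter> B i)}) * real (card {A \<in> Pow (B r). P r A})" by simp
  also have "\<dots> \<le> (c ^ r * 2 ^ card ?J) * (c * 2 ^ card (B r))"
  proof (intro mult_mono)
    show "real (card {A \<in> Pow ?J. \<forall>i<r. P i (A \<inter> B i)}) \<le> c ^ r * 2 ^ card ?J"
    proof (rule Suc.IH)
      show "B i \<subseteq> ?J" if "i < r" for i
        using Suc.prems(2)[of i] Suc.prems(3)[of i r] that by auto
    qed (use Suc.prems in auto)
  qed (use Suc.prems in auto)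
  also have "\<dots> = c ^ Suc r * 2 ^ (card ?J + card (B r))"
    by (simp add: power_add)
  also have "card ?J + card (B r) = card J"
    using Suc.prems(1) Br by (metis card_Diff_subset card_mono diff_add finite_subset)
  finally show ?case .
qed

text \<open>
  For the \<open>i\<close>-th sum to be nonnegative, either its part over \<open>B i\<close> exceeds \<open>- sqrt V / 2\<close>, or its
  part off \<open>B i\<close> reaches \<open>sqrt V / 2\<close>, where \<open>V\<close> is the variance of the former. The first events are
  independent; the second ones have probability at most \<open>4 eta\<close> by Chebyshev.
\<close>

lemma signed_sums_rarely_all_nonneg:
  assumes J: "finite J" and B: "\<And>i. i < r \<Longrightarrow> B i \<subseteq> J" "\<And>i k. i < k \<Longrightarrow> k < r \<Longrightarrow> B i \<inter> B k = {}"
    and pos: "\<And>i. i < r \<Longrightarrow> 0 < (\<Sum>j\<in>B i. (w i j)\<^sup>2)"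
    and dom: "\<And>i. i < r \<Longrightarrow> (\<Sum>j\<in>J - B i. (w i j)\<^sup>2) \<le> eta * (\<Sum>j\<in>B i. (w i j)\<^sup>2)"
  shows "real (card {A \<in> Pow J. \<forall>i<r. 0 \<le> signed_sum (w i) J A})
       \<le> ((29 / 32) ^ r + 4 * real r * eta) * 2 ^ card J"
proof -
  define V where "V i = (\<Sum>j\<in>B i. (w i j)\<^sup>2)" for i
  \<comment> \<open>Zero weights in place of a smaller index set keep all sums over the same sign choices.\<close>
  define v where "v i j = (if j \<in> B i then 0 else w i j)" for i j
  let ?G = "{A \<in> Pow J. \<forall>i<r. - (sqrt (V i) / 2) < signed_sum (w i) (B i) (A \<inter> B i)}"
  let ?C = "\<lambda>i. {A \<in> Pow J. sqrt (V i) / 2 \<le> signed_sum (v i) J A}"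
  have fin: "finite (Pow J)" using J by simp
  have split: "signed_sum (w i) J A = signed_sum (w i) (B i) (A \<inter> B i) + signed_sum (v i) J A" if "i < r" for i A
  proof -
    have "signed_sum (w i) (B i) (A \<inter> B i) = (\<Sum>j\<in>J. if j \<in> B i then (if j \<in> A then - w i j else w i j) else 0)"
      unfolding signed_sum_def using J B(1)[OF that] by (intro sum.mono_neutral_cong_left) auto
    then show ?thesis
      unfolding signed_sum_def[of "w i" J] signed_sum_def[of "v i"]
      by (simp only: sum.distrib[symmetric]) (intro sum.cong, auto simp: v_def)
  qed
  have "{A \<in> Pow J. \<forall>i<r. 0 \<le> signed_sum (w i) J A} \<subseteq> ?G \<union> (\<Union>i<r. ?C i)"
  proof
    fix A assume A: "A \<in> {A \<in> Pow J. \<forall>i<r. 0 \<le> signed_sum (w i) J A}"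
    show "A \<in> ?G \<union> (\<Union>i<r. ?C i)"
    proof (rule ccontr)
      assume "A \<notin> ?G \<union> (\<Union>i<r. ?C i)"
      then obtain i where i: "i < r" "signed_sum (w i) (B i) (A \<inter> B i) \<le> - (sqrt (V i) / 2)"
        "signed_sum (v i) J A < sqrt (V i) / 2"
        using A by (auto simp: not_less not_le)
      then have "signed_sum (w i) J A < 0" using split[OF i(1), of A] by linarith
      then show False using A i(1) by auto
    qed
  qed
  then have "card {A \<in> Pow J. \<forall>i<r. 0 \<le> signed_sum (w i) J A} \<le> card (?G \<union> (\<Union>i<r. ?C i))"
    using fin by (intro card_mono) auto
  also have "\<dots> \<le> card ?G + (\<Sum>i<r. card (?C i))"
    by (intro order_trans[OF card_Un_le] add_mono card_UN_le) auto
  finally have count: "card {A \<in> Pow J. \<forall>i<r. 0 \<le> signed_sum (w i) J A} \<le> card ?G + (\<Sum>i<r. card (?C i))" .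
  have "real (card {A \<in> Pow J. \<forall>i<r. 0 \<le> signed_sum (w i) J A})
      \<le> real (card ?G) + (\<Sum>i<r. real (card (?C i)))"
    using of_nat_mono[OF count, where 'a = real] by (simp only: of_nat_add of_nat_sum)
  moreover have "real (card ?G) \<le> (29 / 32) ^ r * 2 ^ card J"
  proof (rule card_Pow_blocks_le[OF J B])
    fix i assume i: "i < r"
    show "real (card {A \<in> Pow (B i). - (sqrt (V i) / 2) < signed_sum (w i) (B i) A}) \<le> 29 / 32 * 2 ^ card (B i)"
      using pos[OF i] finite_subset[OF B(1)[OF i] J] V_def by (intro signed_sum_often_negative) auto
  qed auto
  moreover have "(\<Sum>i<r. real (card (?C i))) \<le> (\<Sum>i<r. 2 ^ card J * (4 * eta))"
  proof (rule sum_mono)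
    fix i assume "i \<in> {..<r}"
    then have i: "i < r" by simp
    have V: "0 < V i" using pos[OF i] by (simp add: V_def)
    have "real (card (?C i)) \<le> 2 ^ card J * ((\<Sum>j\<in>J. (v i j)\<^sup>2) / (sqrt (V i) / 2)\<^sup>2)"
      using V by (intro signed_sum_Chebyshev[OF J]) simp
    also have "(\<Sum>j\<in>J. (v i j)\<^sup>2) = (\<Sum>j\<in>J - B i. (w i j)\<^sup>2)"
      using J by (intro sum.mono_neutral_cong_right) (auto simp: v_def)
    also have "(sqrt (V i) / 2)\<^sup>2 = V i / 4" using V by (simp add: power_divide)
    also have "2 ^ card J * ((\<Sum>j\<in>J - B i. (w i j)\<^sup>2) / (V i / 4)) \<le> 2 ^ card J * (4 * eta)"
      using dom[OF i] V by (intro mult_left_mono) (auto simp: V_def[symmetric] field_simps)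
    finally show "real (card (?C i)) \<le> 2 ^ card J * (4 * eta)" .
  qed
  ultimately show ?thesis by (simp add: algebra_simps)
qed

section \<open>Exchanging columns and rows\<close>

abbreviation square_side :: "nat \<times> (nat \<Rightarrow> nat) \<times> (nat \<Rightarrow> nat) \<Rightarrow> nat" where
  "square_side x \<equiv> fst x"

abbreviation right_gap :: "nat \<times> (nat \<Rightarrow> nat) \<times> (nat \<Rightarrow> nat) \<Rightarrow> nat \<Rightarrow> nat" where
  "right_gap x \<equiv> fst (snd x)"

abbreviation below_gap :: "nat \<times> (nat \<Rightarrow> nat) \<times> (nat \<Rightarrow> nat) \<Rightarrow> nat \<Rightarrow> nat" where
  "below_gap x \<equiv> snd (snd x)"

definition imbalance :: "nat \<times> (nat \<Rightarrow> nat) \<times> (nat \<Rightarrow> nat) \<Rightarrow> nat \<Rightarrow> real" where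
  "imbalance x j = real (right_gap x j) - real (below_gap x j)"

text \<open>
  Conjugation is the case \<open>A = UNIV\<close>.
\<close>

definition flip :: "nat set \<Rightarrow> nat \<times> (nat \<Rightarrow> nat) \<times> (nat \<Rightarrow> nat) \<Rightarrow> nat \<times> (nat \<Rightarrow> nat) \<times> (nat \<Rightarrow> nat)" where
  "flip A = (\<lambda>(D, a, b). (D, \<lambda>j. if j \<in> A then b j else a j, \<lambda>j. if j \<in> A then a j else b j))"

lemma durfee_data_iff:
  "x \<in> durfee_data n \<longleftrightarrow> (\<forall>j\<ge>square_side x. right_gap x j = 0 \<and> below_gap x j = 0) \<and>
     square_side x * square_side x + (\<Sum>j<square_side x. Suc j * (right_gap x j + below_gap x j)) = n"
  unfolding durfee_data_def by (cases x) simp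

lemma square_side_sq_le: "x \<in> durfee_data n \<Longrightarrow> square_side x * square_side x \<le> n"
  unfolding durfee_data_iff by linarith

lemma square_side_le:
  assumes "x \<in> durfee_data n"
  shows "square_side x \<le> n"
  using square_side_sq_le[OF assms] by (cases "square_side x") auto

lemma square_side_flip [simp]: "square_side (flip A x) = square_side x"
  by (cases x) (simp add: flip_def)

lemma right_gap_flip [simp]: "right_gap (flip A x) j = (if j \<in> A then below_gap x j else right_gap x j)"
  by (cases x) (simp add: flip_def)

lemma below_gap_flip [simp]: "below_gap (flip A x) j = (if j \<in> A then right_gap x j else below_gap x j)"
  by (cases x) (simp add: flip_def)

lemma imbalance_flip [simp]: "imbalance (flip A x) j = (if j \<in> A then - imbalance x j else imbalance x j)"
  by (simp add: imbalance_def)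

lemma flip_flip [simp]: "flip A (flip A x) = x"
  by (cases x) (simp add: flip_def fun_eq_iff)

lemma flip_durfee_data:
  assumes "x \<in> durfee_data n"
  shows "flip A x \<in> durfee_data n"
proof -
  have "(\<Sum>j<square_side x. Suc j * (right_gap (flip A x) j + below_gap (flip A x) j)) =
        (\<Sum>j<square_side x. Suc j * (right_gap x j + below_gap x j))"
    by (intro sum.cong) auto
  then show ?thesis using assms unfolding durfee_data_iff square_side_flip by simp
qed

lemma bij_betw_flip: "bij_betw (flip A) (durfee_data n) (durfee_data n)"
  by (rule bij_betw_byWitness[where f' = "flip A"]) (auto simp: flip_durfee_data)

lemma imbalance_beyond_square:
  assumes "x \<in> durfee_data n" "square_side x \<le> j"
  shows "imbalance x j = 0"
  using assms unfolding durfee_data_iff imbalance_def by simp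

text \<open>
  The columns of height at most \<open>D\<close> in the whole diagram are those to the right of the square,
  except that columns of the square itself may have height \<open>D\<close>.
\<close>

lemma right_gap_le_gap_glue:
  assumes "x \<in> durfee_data n"
  shows "right_gap x j \<le> gap (glue x) j"
proof (cases x)
  case (fields D a b)
  consider "D \<le> j" | "Suc j = D" | "Suc j < D" by linarith
  then show ?thesis
  proof cases
    case 1
    then show ?thesis using assms unfolding durfee_data_iff by (simp add: fields)
  next
    case 2
    have "card {l \<in> {..<D}. D < arm D b l} \<le> card {..<D}" by (intro card_mono) auto
    moreover have "arm D a j = a j + D" using 2 arm_step[of j D a] by (simp add: arm_def)
    ultimately show ?thesis using 2 by (simp add: fields gap_def glue_def)
  next
    case 3
    then show ?thesis using arm_step[of j D a] by (simp add: fields gap_def glue_def)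
  qed
qed

lemma gap_glue_inside_square:
  assumes "Suc j < square_side x"
  shows "gap (glue x) j = right_gap x j"
  using assms arm_step[of j "square_side x" "right_gap x"]
  by (cases x) (simp add: gap_def glue_def)

text \<open>
  Beyond the range of \<open>gap_second_moment\<close> the multiplicities vanish, since \<open>D\<^sup>2 \<le> n\<close>.
\<close>

lemma sum_right_gap_sq_le:
  assumes "0 < n"
  shows "(real (Suc j))\<^sup>2 * (\<Sum>x\<in>durfee_data n. (real (right_gap x j))\<^sup>2) \<le> 640 * real n * pnum n"
proof -
  obtain H where H: "0 < H" "8 * n \<le> H * H" "H * H \<le> 16 * n"
    using ex_sqrt_scale[OF assms] by blast
  show ?thesis
  proof (cases "Suc j \<le> H")
    case True
    have "(\<Sum>x\<in>durfee_data n. (real (right_gap x j))\<^sup>2) \<le> (\<Sum>x\<in>durfee_data n. (real (gap (glue x) j))\<^sup>2)"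
      using right_gap_le_gap_glue by (intro sum_mono power_mono) auto
    also have "\<dots> = (\<Sum>p\<in>partitions_of n. (real (gap p j))\<^sup>2)"
      by (rule sum.reindex_bij_betw[OF bij_betw_glue])
    finally have "(real (Suc j))\<^sup>2 * (\<Sum>x\<in>durfee_data n. (real (right_gap x j))\<^sup>2)
        \<le> (real (Suc j))\<^sup>2 * (\<Sum>p\<in>partitions_of n. (real (gap p j))\<^sup>2)"
      by (intro mult_left_mono) auto
    also have "\<dots> \<le> 40 * (real H)\<^sup>2 * pnum n" by (rule gap_second_moment[OF H(2,1) True])
    also have "\<dots> \<le> 40 * (16 * real n) * pnum n"
      using of_nat_mono[OF H(3), where 'a = real]
      by (intro mult_right_mono mult_left_mono) (auto simp: power2_eq_square)
    finally show ?thesis by simp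
  next
    case False
    have "right_gap x j = 0" if x: "x \<in> durfee_data n" for x
    proof -
      have "\<not> H < square_side x"
      proof
        assume "H < square_side x"
        then have "H * H < square_side x * square_side x" by (intro mult_strict_mono) auto
        then show False using square_side_sq_le[OF x] H(2) assms by linarith
      qed
      then show ?thesis using x False unfolding durfee_data_iff by simp
    qed
    then show ?thesis by simp
  qed
qed

lemma sum_below_gap_sq:
  "(\<Sum>x\<in>durfee_data n. (real (below_gap x j))\<^sup>2) = (\<Sum>x\<in>durfee_data n. (real (right_gap x j))\<^sup>2)"
  using sum.reindex_bij_betw[OF bij_betw_flip[of UNIV n], of "\<lambda>x. (real (right_gap x j))\<^sup>2"] by simp

lemma sum_imbalance_sq_le:
  assumes "0 < n"
  shows "(real (Suc j))\<^sup>2 * (\<Sum>x\<in>durfee_data n. (imbalance x j)\<^sup>2) \<le> 1280 * real n * pnum n"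
proof -
  have "(\<Sum>x\<in>durfee_data n. (imbalance x j)\<^sup>2)
      \<le> (\<Sum>x\<in>durfee_data n. (real (right_gap x j))\<^sup>2 + (real (below_gap x j))\<^sup>2)"
    unfolding imbalance_def by (intro sum_mono) (simp add: power2_diff)
  also have "\<dots> = 2 * (\<Sum>x\<in>durfee_data n. (real (right_gap x j))\<^sup>2)"
    by (simp add: sum.distrib sum_below_gap_sq)
  finally have "(real (Suc j))\<^sup>2 * (\<Sum>x\<in>durfee_data n. (imbalance x j)\<^sup>2)
      \<le> (real (Suc j))\<^sup>2 * (2 * (\<Sum>x\<in>durfee_data n. (real (right_gap x j))\<^sup>2))"
    by (intro mult_left_mono) auto
  then show ?thesis using sum_right_gap_sq_le[OF assms, of j] by linarith
qed

text \<open>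
  If \<open>D \<le> K\<close>, at least \<open>n - K\<^sup>2\<close> cells lie in columns or rows of length at most \<open>K\<close> outside the
  square, whereas the expected number of cells in those of any given length is of order \<open>sqrt n\<close>.
\<close>

lemma small_square_count:
  assumes n: "0 < n"
  shows "(real n - real (K * K)) * real (card {x \<in> durfee_data n. square_side x \<le> K})
       \<le> 1282 * real K * sqrt (real n) * pnum n"
proof -
  let ?F = "{x \<in> durfee_data n. square_side x \<le> K}"
  let ?T = "durfee_data n"
  define s where "s = sqrt (real n)"
  have s: "0 < s" "s * s = real n" using n by (auto simp: s_def)
  \<comment> \<open>Reduces first moments to the second moments at hand.\<close>
  have lin: "y \<le> s + y\<^sup>2 / s" if "0 \<le> y" for y :: real
  proof (cases "y \<le> s")
    case False
    then have "y * s \<le> y * y" using that by (intro mult_left_mono) auto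
    then have "y \<le> y\<^sup>2 / s" using s by (simp add: field_simps power2_eq_square)
    then show ?thesis using s by linarith
  qed (use s that in \<open>simp add: add_increasing2\<close>)
  have first: "(\<Sum>x\<in>?T. real (Suc j * right_gap x j)) \<le> 641 * s * pnum n" for j
  proof -
    have "(\<Sum>x\<in>?T. real (Suc j * right_gap x j)) \<le> (\<Sum>x\<in>?T. s + (real (Suc j * right_gap x j))\<^sup>2 / s)"
      by (intro sum_mono lin) simp
    also have "\<dots> = s * pnum n + ((real (Suc j))\<^sup>2 * (\<Sum>x\<in>?T. (real (right_gap x j))\<^sup>2)) / s"
      unfolding of_nat_mult power_mult_distrib
      by (simp only: sum.distrib sum_divide_distrib[symmetric] sum_distrib_left[symmetric] sum_constant
          card_durfee_data mult.commute)
    also have "\<dots> \<le> s * pnum n + (640 * real n * pnum n) / s"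
      using sum_right_gap_sq_le[OF n, of j] s by (intro add_left_mono divide_right_mono) auto
    also have "(640 * real n * pnum n) / s = 640 * s * pnum n"
      using s by (simp add: field_simps flip: s(2))
    finally show ?thesis by (simp add: algebra_simps)
  qed
  have second: "(\<Sum>x\<in>?T. real (Suc j * below_gap x j)) = (\<Sum>x\<in>?T. real (Suc j * right_gap x j))" for j
    using sum.reindex_bij_betw[OF bij_betw_flip[of UNIV n], of "\<lambda>x. real (Suc j * right_gap x j)"] by simp
  have "(real n - real (K * K)) * real (card ?F) = (\<Sum>x\<in>?F. real n - real (K * K))" by simp
  also have "\<dots> \<le> (\<Sum>x\<in>?F. \<Sum>j<K. real (Suc j * right_gap x j) + real (Suc j * below_gap x j))"
  proof (rule sum_mono)
    fix x assume "x \<in> ?F"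
    then have x: "x \<in> ?T" "square_side x \<le> K" by auto
    have "n = square_side x * square_side x + (\<Sum>j<square_side x. Suc j * (right_gap x j + below_gap x j))"
      using x(1) unfolding durfee_data_iff by simp
    also have "\<dots> \<le> K * K + (\<Sum>j<K. Suc j * (right_gap x j + below_gap x j))"
      using x(2) by (intro add_mono mult_mono sum_mono2) auto
    finally have "real n \<le> real (K * K + (\<Sum>j<K. Suc j * (right_gap x j + below_gap x j)))"
      by (rule of_nat_mono)
    then show "real n - real (K * K) \<le> (\<Sum>j<K. real (Suc j * right_gap x j) + real (Suc j * below_gap x j))"
      by (simp only: of_nat_add of_nat_sum of_nat_mult distrib_left)
  qed
  also have "\<dots> \<le> (\<Sum>x\<in>?T. \<Sum>j<K. real (Suc j * right_gap x j) + real (Suc j * below_gap x j))"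
    using finite_durfee_data by (intro sum_mono2 sum_nonneg) auto
  also have "\<dots> = (\<Sum>j<K. 2 * (\<Sum>x\<in>?T. real (Suc j * right_gap x j)))"
    unfolding sum.swap[of _ _ ?T] sum.distrib second by (simp only: mult_2 sum.distrib)
  also have "\<dots> \<le> (\<Sum>j<K. 2 * (641 * s * pnum n))"
    by (intro sum_mono mult_left_mono first) simp
  finally show ?thesis by (simp add: s_def)
qed

lemma small_square_rare:
  assumes "2 * (K * K) \<le> n" "0 < n"
  shows "real (card {x \<in> durfee_data n. square_side x \<le> K}) \<le> 2564 * real K / sqrt (real n) * pnum n"
proof -
  let ?c = "real (card {x \<in> durfee_data n. square_side x \<le> K})"
  define s where "s = sqrt (real n)"
  have s: "0 < s" "s * s = real n" using assms by (auto simp: s_def)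
  have "real (2 * (K * K)) \<le> real n" using assms(1) by (rule of_nat_mono)
  then have "real n / 2 \<le> real n - real (K * K)" by simp
  then have "real n / 2 * ?c \<le> (real n - real (K * K)) * ?c" by (intro mult_right_mono) auto
  also have "\<dots> \<le> 1282 * real K * s * pnum n"
    unfolding s_def by (rule small_square_count[OF assms(2)])
  finally have "s * (s * ?c) \<le> s * (2564 * real K * pnum n)"
    by (simp add: algebra_simps flip: s(2))
  then have "s * ?c \<le> 2564 * real K * pnum n"
    by (rule mult_left_le_imp_le) (rule s(1))
  then show ?thesis using s(1) unfolding s_def[symmetric] by (simp add: field_simps)
qed

text \<open>
  Moving multiplicity from \<open>a\<close> to \<open>b\<close> at index \<open>j\<close> preserves the size and changes the imbalance
  there by twice the amount moved.
\<close>

definition shift_gap :: "nat \<Rightarrow> nat \<Rightarrow> nat \<times> (nat \<Rightarrow> nat) \<times> (nat \<Rightarrow> nat) \<Rightarrow> nat \<times> (nat \<Rightarrow> nat) \<times> (nat \<Rightarrow> nat)" where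
  "shift_gap j u = (\<lambda>(D, a, b). (D, a(j := a j - u), b(j := b j + u)))"

lemma shift_gap_durfee_data:
  assumes "x \<in> durfee_data n" "u \<le> right_gap x j" "j < square_side x"
  shows "shift_gap j u x \<in> durfee_data n"
proof (cases x)
  case (fields D a b)
  have "(\<Sum>i<D. Suc i * ((a(j := a j - u)) i + (b(j := b j + u)) i)) = (\<Sum>i<D. Suc i * (a i + b i))"
    using assms(2) by (intro sum.cong) (auto simp: fields)
  then show ?thesis
    using assms unfolding durfee_data_def by (simp add: fields shift_gap_def del: mult_Suc)
qed

lemma shift_gap_inverse:
  assumes "u \<le> right_gap x j" "u \<le> right_gap y j" "shift_gap j u x = shift_gap j u y"
  shows "x = y"
proof -
  obtain D a b D' a' b' where xy: "x = (D, a, b)" "y = (D', a', b')" by (cases x, cases y)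
  have a: "a(j := a j - u) = a'(j := a' j - u)" and b: "b(j := b j + u) = b'(j := b' j + u)" and "D = D'"
    using assms(3) by (auto simp: xy shift_gap_def)
  have "a i = a' i" for i
    using fun_cong[OF a, of i] assms(1,2) by (cases "i = j") (auto simp: xy)
  moreover have "b i = b' i" for i
    using fun_cong[OF b, of i] by (cases "i = j") auto
  ultimately show ?thesis using \<open>D = D'\<close> by (auto simp: xy)
qed

lemma imbalance_shift_gap:
  assumes "u \<le> right_gap x j"
  shows "imbalance (shift_gap j u x) j = imbalance x j - 2 * real u"
  using assms by (cases x) (simp add: imbalance_def shift_gap_def of_nat_diff)

text \<open>
  Shifting by \<open>i * t\<close> for \<open>i < q\<close> moves the imbalance from the window of radius \<open>t\<close> around \<open>0\<close> to
  the one around \<open>- 2 i t\<close>. These windows are disjoint, so the \<open>q\<close> images of the set are disjoint.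
\<close>

lemma small_imbalance_large_gap_rare:
  assumes "0 < t" "q * t \<le> M"
  shows "real q * real (card {x \<in> durfee_data n. \<bar>imbalance x j\<bar> < real t \<and> 0 < right_gap x j \<and> M \<le> right_gap x j}) \<le> pnum n"
proof -
  let ?X = "{x \<in> durfee_data n. \<bar>imbalance x j\<bar> < real t \<and> 0 < right_gap x j \<and> M \<le> right_gap x j}"
  let ?f = "\<lambda>(i, x). shift_gap j (i * t) x"
  have le: "i * t \<le> right_gap x j" if "i < q" "x \<in> ?X" for i x
  proof -
    have "i * t \<le> q * t" using that(1) by (intro mult_le_mono1) simp
    moreover have "M \<le> right_gap x j" using that(2) by simp
    ultimately show ?thesis using assms(2) by linarith
  qed
  have inj: "inj_on ?f ({..<q} \<times> ?X)"
  proof (rule inj_onI)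
    fix z z' assume z: "z \<in> {..<q} \<times> ?X" "z' \<in> {..<q} \<times> ?X" and eq: "?f z = ?f z'"
    obtain i x i' x' where zz: "z = (i, x)" "z' = (i', x')" by (cases z, cases z')
    have ix: "i < q" "x \<in> ?X" "i' < q" "x' \<in> ?X" using z by (auto simp: zz)
    have eq': "shift_gap j (i * t) x = shift_gap j (i' * t) x'" using eq by (simp add: zz)
    have "imbalance x j - 2 * real (i * t) = imbalance x' j - 2 * real (i' * t)"
      using imbalance_shift_gap[OF le[OF ix(1,2)]] imbalance_shift_gap[OF le[OF ix(3,4)]] eq' by simp
    moreover have "\<bar>imbalance x j\<bar> < real t" "\<bar>imbalance x' j\<bar> < real t" using ix by auto
    ultimately have "\<bar>real (i * t) - real (i' * t)\<bar> < real t" by linarith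
    then have "\<bar>real i - real i'\<bar> * real t < 1 * real t"
      by (simp add: left_diff_distrib[symmetric] abs_mult)
    then have "\<bar>real i - real i'\<bar> < 1" by (rule mult_right_less_imp_less) simp
    then have "i = i'" by linarith
    then show "z = z'" using shift_gap_inverse[OF _ _ eq'[unfolded \<open>i = i'\<close>]] le ix by (simp add: zz)
  qed
  have "?f ` ({..<q} \<times> ?X) \<subseteq> durfee_data n"
  proof
    fix y assume "y \<in> ?f ` ({..<q} \<times> ?X)"
    then obtain i x where ix: "i < q" "x \<in> ?X" "y = shift_gap j (i * t) x" by auto
    have "j < square_side x"
    proof (rule ccontr)
      assume "\<not> j < square_side x"
      then have "right_gap x j = 0" using ix(2) unfolding durfee_data_iff by simp
      then show False using ix(2) by simp
    qed
    then show "y \<in> durfee_data n"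
      unfolding ix(3) using ix(2) by (intro shift_gap_durfee_data le[OF ix(1,2)]) auto
  qed
  then have "card ({..<q} \<times> ?X) \<le> card (durfee_data n)"
    by (rule card_inj_on_le[OF inj _ finite_durfee_data])
  then have "q * card ?X \<le> card (partitions_of n)"
    unfolding card_cartesian_product card_lessThan card_durfee_data .
  from of_nat_mono[OF this, where 'a = real] show ?thesis unfolding of_nat_mult .
qed

lemma small_right_gap_count:
  assumes "Suc j * M \<le> n"
  shows "real (card {x \<in> durfee_data n. Suc j < square_side x \<and> right_gap x j < M}) \<le> pnum n - pnum (n - Suc j * M)"
proof -
  have "card {x \<in> durfee_data n. Suc j < square_side x \<and> right_gap x j < M} \<le> card {p \<in> partitions_of n. gap p j < M}"
  proof (rule card_inj_on_le)
    show "inj_on glue {x \<in> durfee_data n. Suc j < square_side x \<and> right_gap x j < M}"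
      by (rule inj_on_subset[OF inj_on_glue]) auto
    show "glue ` {x \<in> durfee_data n. Suc j < square_side x \<and> right_gap x j < M} \<subseteq> {p \<in> partitions_of n. gap p j < M}"
      using bij_betwE[OF bij_betw_glue] by (auto simp: gap_glue_inside_square)
  qed (simp add: finite_partitions_of)
  then show ?thesis using card_small_gap[OF assms] by simp
qed

section \<open>Typical size of the imbalances\<close>

text \<open>
  Three rare events cover a small imbalance: the square has side at most \<open>K\<close>; or there are fewer
  than \<open>M\<close> columns of height \<open>Suc j\<close>, which is rare by \<open>pnum_continuity\<close>; or neither of these holds
  and the imbalance is small relative to \<open>M\<close>. It matters below that \<open>th\<close> is chosen before \<open>K\<close>.
\<close>

lemma small_imbalance_rare:
  assumes "0 < e"
  obtains th where "0 < th"
    "\<And>K. \<exists>n0. \<forall>n\<ge>n0. \<forall>j<K.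
       real (card {x \<in> durfee_data n. real (Suc j) * \<bar>imbalance x j\<bar> < th * sqrt (real n)}) \<le> e * pnum n"
proof -
  obtain d n1 where d: "0 < d" "d \<le> 1" and
    cont: "\<And>n m. n1 \<le> n \<Longrightarrow> real m \<le> d * sqrt (real n) \<Longrightarrow> m \<le> n \<and> pnum n - pnum (n - m) \<le> e / 3 * pnum n"
    using pnum_continuity[of "e / 3"] assms by auto
  define q where "q = nat \<lceil>3 / e\<rceil>"
  have q: "3 / e \<le> real q" unfolding q_def by linarith
  have "0 < 3 / e" using assms by simp
  then have "0 < q" using q by (cases q) auto
  \<comment> \<open>The factor \<open>2\<close> absorbs the rounding in \<open>M\<close> and \<open>t\<close> below.\<close>
  define th where "th = d / (2 * real q)"
  show thesis
  proof (rule that[of th])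
    show "0 < th" using d(1) \<open>0 < q\<close> by (simp add: th_def)
    fix K :: nat
    define C where "C = 7692 * real K / e + 2 * real K * (real q + 1) / d"
    have "0 \<le> C" using assms d by (simp add: C_def)
    define n0 where "n0 = n1 + 2 * (K * K) + 1 + nat \<lceil>C\<^sup>2\<rceil>"
    show "\<exists>n0. \<forall>n\<ge>n0. \<forall>j<K.
       real (card {x \<in> durfee_data n. real (Suc j) * \<bar>imbalance x j\<bar> < th * sqrt (real n)}) \<le> e * pnum n"
    proof (intro exI allI impI)
      fix n j assume n: "n0 \<le> n" and j: "j < K"
      define s where "s = sqrt (real n)"
      have n_pos: "0 < n" and n1: "n1 \<le> n" and nK: "2 * (K * K) \<le> n" using n by (auto simp: n0_def)
      have "C\<^sup>2 \<le> real (nat \<lceil>C\<^sup>2\<rceil>)" by linarith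
      also have "\<dots> \<le> real n" using n by (intro of_nat_mono) (unfold n0_def, linarith)
      finally have Cs: "C \<le> s" unfolding s_def by (rule real_le_rsqrt)
      have s: "0 < s" using n_pos by (simp add: s_def)
      have "7692 * real K / e \<le> s" using Cs d by (auto simp: C_def intro: order_trans[rotated])
      then have sq: "2564 * real K / s \<le> e / 3" using s assms by (simp add: field_simps)
      have "0 \<le> 7692 * real K / e" using assms by simp
      then have "2 * real K * (real q + 1) / d \<le> s" using Cs unfolding C_def by linarith
      then have "(real q + 1) * (2 * real K) \<le> d * s" using d(1) by (simp add: field_simps)
      moreover have "(real q + 1) * (2 * real (Suc j)) \<le> (real q + 1) * (2 * real K)"
        using j by (intro mult_left_mono) auto
      ultimately have qs: "(real q + 1) * (2 * real (Suc j)) \<le> d * s" by linarith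
      define y where "y = d * s / real (Suc j)"
      have y: "2 * (real q + 1) \<le> y" using qs unfolding y_def by (simp only: pos_le_divide_eq of_nat_0_less_iff zero_less_Suc mult_ac)
      define M where "M = nat \<lfloor>y\<rfloor>"
      have "0 < y" using y by (rule less_le_trans[rotated]) simp
      then have M: "real M \<le> y" "y < real M + 1" unfolding M_def by linarith+
      define t where "t = M div q"
      have "M < q * t + q" unfolding t_def using \<open>0 < q\<close>
        by (metis add_less_cancel_left mod_less_divisor mult_div_mod_eq)
      then have "real M < real q * real t + real q" by (metis of_nat_add of_nat_less_iff of_nat_mult)
      then have "y < real q * real t + (real q + 1)" using M(2) by linarith
      then have "y / 2 < real q * real t" using y by (simp add: field_simps)
      then have t: "y / (2 * real q) < real t" using \<open>0 < q\<close> by (simp add: field_simps)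
      have "0 < y / (2 * real q)" using \<open>0 < q\<close> \<open>0 < y\<close> by simp
      then have t_pos: "0 < t" using t by (cases t) auto
      have qt: "q * t \<le> M" unfolding t_def by simp
      then have M_pos: "0 < M" using t_pos \<open>0 < q\<close> by (cases M) auto
      have "real (Suc j * M) \<le> d * s"
        using M(1) unfolding y_def of_nat_mult by (simp only: pos_le_divide_eq of_nat_0_less_iff zero_less_Suc mult_ac)
      then have JM: "Suc j * M \<le> n" "pnum n - pnum (n - Suc j * M) \<le> e / 3 * pnum n"
        using cont[OF n1, of "Suc j * M"] unfolding s_def by auto
      let ?T = "durfee_data n"
      let ?X = "{x \<in> ?T. square_side x \<le> K}"
      let ?Y = "{x \<in> ?T. Suc j < square_side x \<and> right_gap x j < M}"
      let ?Z = "{x \<in> ?T. \<bar>imbalance x j\<bar> < real t \<and> 0 < right_gap x j \<and> M \<le> right_gap x j}"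
      have "{x \<in> ?T. real (Suc j) * \<bar>imbalance x j\<bar> < th * s} \<subseteq> ?X \<union> ?Y \<union> ?Z"
      proof
        fix x assume x: "x \<in> {x \<in> ?T. real (Suc j) * \<bar>imbalance x j\<bar> < th * s}"
        then have "\<bar>imbalance x j\<bar> * real (Suc j) < th * s" by (simp add: mult.commute)
        then have "\<bar>imbalance x j\<bar> < th * s / real (Suc j)"
          by (simp only: pos_less_divide_eq of_nat_0_less_iff zero_less_Suc)
        also have "th * s / real (Suc j) = y / (2 * real q)" by (simp add: th_def y_def)
        finally have "\<bar>imbalance x j\<bar> < real t" using t by linarith
        then show "x \<in> ?X \<union> ?Y \<union> ?Z" using x j M_pos by auto
      qed
      then have "card {x \<in> ?T. real (Suc j) * \<bar>imbalance x j\<bar> < th * s} \<le> card (?X \<union> ?Y \<union> ?Z)"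
        using finite_durfee_data by (intro card_mono) auto
      also have "\<dots> \<le> card ?X + card ?Y + card ?Z"
        by (meson add_right_mono card_Un_le order_trans)
      finally have "real (card {x \<in> ?T. real (Suc j) * \<bar>imbalance x j\<bar> < th * s}) \<le> real (card ?X + card ?Y + card ?Z)"
        by (rule of_nat_mono)
      moreover have "real (card ?X) \<le> e / 3 * pnum n"
      proof -
        have "real (card ?X) \<le> 2564 * real K / s * pnum n"
          unfolding s_def by (rule small_square_rare[OF nK n_pos])
        also have "\<dots> \<le> e / 3 * pnum n" using sq by (rule mult_right_mono) simp
        finally show ?thesis .
      qed
      moreover have "real (card ?Y) \<le> e / 3 * pnum n"
        using small_right_gap_count[OF JM(1)] JM(2) by linarith
      moreover have "real (card ?Z) \<le> e / 3 * pnum n"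
      proof -
        have "3 / e * real (card ?Z) \<le> real q * real (card ?Z)" using q by (rule mult_right_mono) simp
        also have "\<dots> \<le> pnum n" by (rule small_imbalance_large_gap_rare[OF t_pos qt])
        finally show ?thesis using assms by (simp add: field_simps)
      qed
      ultimately show "real (card {x \<in> ?T. real (Suc j) * \<bar>imbalance x j\<bar> < th * sqrt (real n)}) \<le> e * pnum n"
        unfolding s_def of_nat_add by linarith
    qed
  qed
qed

text \<open>
  Already the indices from \<open>l\<close> to \<open>k = l R\<close> suffice. There are at least \<open>k/2\<close> of them, each with
  weight \<open>Suc j\<close>; if the variance is small, at least \<open>k/4\<close> of them have a small imbalance, which
  is rare by Markov's inequality.
\<close>

lemma block_variance_rarely_small:
  assumes l: "0 < l" and R: "2 \<le> R" and th: "0 < th"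
    and rare: "\<And>j. j < l * R \<Longrightarrow>
      real (card {x \<in> durfee_data n. real (Suc j) * \<bar>imbalance x j\<bar> < th * sqrt (real n)}) \<le> e * pnum n"
  shows "real (card {x \<in> durfee_data n.
      (\<Sum>j\<in>{l..<l * R * R}. (real (min (Suc j) (l * R)) * imbalance x j)\<^sup>2) < real (l * R) * (th\<^sup>2 * real n) / 4})
      \<le> 4 * e * pnum n"
proof -
  define k where "k = l * R"
  have k: "0 < k" "2 * l \<le> k" using l R by (auto simp: k_def)
  let ?T = "durfee_data n"
  let ?small = "\<lambda>x j. real (Suc j) * \<bar>imbalance x j\<bar> < th * sqrt (real n)"
  let ?I = "{l..<k}"
  let ?V = "\<lambda>x. \<Sum>j\<in>{l..<k * R}. (real (min (Suc j) k) * imbalance x j)\<^sup>2"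
  let ?F = "{x \<in> ?T. ?V x < real k * (th\<^sup>2 * real n) / 4}"
  have many: "real k / 4 \<le> real (card {j \<in> ?I. ?small x j})" if x: "x \<in> ?F" for x
  proof -
    let ?L = "{j \<in> ?I. \<not> ?small x j}"
    have "real (card ?L) * (th\<^sup>2 * real n) = (\<Sum>j\<in>?L. th\<^sup>2 * real n)" by simp
    also have "\<dots> \<le> (\<Sum>j\<in>?L. (real (min (Suc j) k) * imbalance x j)\<^sup>2)"
    proof (rule sum_mono)
      fix j assume j: "j \<in> ?L"
      then have "(th * sqrt (real n))\<^sup>2 \<le> (real (Suc j) * \<bar>imbalance x j\<bar>)\<^sup>2"
        using th by (intro power_mono) auto
      then have "th\<^sup>2 * real n \<le> (real (Suc j) * imbalance x j)\<^sup>2"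
        by (simp add: power_mult_distrib)
      moreover have "min (Suc j) k = Suc j" using j by auto
      ultimately show "th\<^sup>2 * real n \<le> (real (min (Suc j) k) * imbalance x j)\<^sup>2" by simp
    qed
    also have "\<dots> \<le> ?V x"
    proof (rule sum_mono2)
      have "k \<le> k * R" using R by simp
      then have "j < k * R" if "j < k" for j by (rule less_le_trans[OF that])
      then show "?L \<subseteq> {l..<k * R}" by auto
    qed auto
    also have "\<dots> < real k * (th\<^sup>2 * real n) / 4" using x by simp
    finally have "real (card ?L) * (th\<^sup>2 * real n) < real k / 4 * (th\<^sup>2 * real n)" by simp
    then have "real (card ?L) < real k / 4" by (rule mult_right_less_imp_less) simp
    have "card ({j \<in> ?I. ?small x j} \<union> ?L) = card {j \<in> ?I. ?small x j} + card ?L"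
      by (rule card_Un_disjoint) auto
    moreover have "{j \<in> ?I. ?small x j} \<union> ?L = ?I" by blast
    ultimately have "card {j \<in> ?I. ?small x j} + card ?L = card ?I" by (simp only:)
    then have "real (card {j \<in> ?I. ?small x j}) + real (card ?L) = real k - real l"
      using k by (simp add: of_nat_diff flip: of_nat_add)
    moreover have "2 * real l \<le> real k" using of_nat_mono[OF k(2), where 'a = real] by simp
    ultimately show ?thesis using \<open>real (card ?L) < real k / 4\<close> by linarith
  qed
  have "real (card ?F) * (real k / 4) = (\<Sum>x\<in>?F. real k / 4)" by simp
  also have "\<dots> \<le> (\<Sum>x\<in>?F. real (card {j \<in> ?I. ?small x j}))" by (intro sum_mono many)
  also have "\<dots> \<le> (\<Sum>x\<in>?T. real (card {j \<in> ?I. ?small x j}))"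
    using finite_durfee_data by (intro sum_mono2) auto
  also have "\<dots> = (\<Sum>j\<in>?I. real (card {x \<in> ?T. ?small x j}))"
    by (rule sum_card_swap[symmetric]) (auto simp: finite_durfee_data)
  also have "\<dots> \<le> (\<Sum>j\<in>?I. e * pnum n)" by (intro sum_mono rare) (auto simp: k_def)
  also have "\<dots> = real (k - l) * (e * pnum n)" by simp
  also have "\<dots> \<le> real k * (e * pnum n)"
  proof (intro mult_right_mono)
    show "0 \<le> e * pnum n" using rare[of 0] l R by (intro order_trans[OF _ rare[of 0]]) auto
  qed simp
  finally have "real k * real (card ?F) \<le> real k * (4 * e * pnum n)" by (simp add: mult_ac)
  then have "real (card ?F) \<le> 4 * e * pnum n" by (rule mult_left_le_imp_le) (use k in simp)
  then show ?thesis by (simp add: k_def)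
qed

lemma sum_inverse_squares_le:
  assumes "0 < m" "m \<le> n"
  shows "(\<Sum>j\<in>{m..<n}. 1 / (real (Suc j))\<^sup>2) \<le> 1 / real m - 1 / real n"
  using assms(2)
proof (induction rule: dec_induct)
  case (step k)
  have k: "real k > 0" using step assms by simp
  then have "1 / (real (Suc k))\<^sup>2 \<le> 1 / (real k * real (Suc k))"
    by (intro divide_left_mono) (auto simp: power2_eq_square)
  also have "\<dots> = 1 / real k - 1 / real (Suc k)" using k by (simp add: field_simps)
  finally have "1 / (real (Suc k))\<^sup>2 \<le> 1 / real k - 1 / real (Suc k)" .
  then show ?case using step by simp
qed simp

text \<open>
  Markov's inequality. Below the block the \<open>l\<close> terms have mean of order \<open>n\<close> each; above it, those
  of weight \<open>k = l R\<close> sum to a mean of order \<open>n k\<^sup>2 / (l R\<^sup>2) = n l\<close>.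
\<close>

lemma off_block_variance_rarely_large:
  assumes l: "0 < l" and R: "0 < R" and n: "l * R * R \<le> n" and c: "0 < c"
  shows "real (card {x \<in> durfee_data n.
      c < (\<Sum>j\<in>{..<n} - {l..<l * R * R}. (real (min (Suc j) (l * R)) * imbalance x j)\<^sup>2)})
      \<le> 2560 * real n * real l / c * pnum n"
proof -
  define k where "k = l * R"
  define m where "m = l * R * R"
  have m: "0 < m" "m \<le> n" using l R n by (auto simp: m_def)
  let ?T = "durfee_data n"
  let ?J = "{..<n} - {l..<m}"
  let ?W = "\<lambda>x. \<Sum>j\<in>?J. (real (min (Suc j) k) * imbalance x j)\<^sup>2"
  let ?F = "{x \<in> ?T. c < ?W x}"
  define E where "E = 1280 * real n * pnum n"
  have "0 \<le> E" by (simp add: E_def)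
  have E: "(real (Suc j))\<^sup>2 * (\<Sum>x\<in>?T. (imbalance x j)\<^sup>2) \<le> E" for j
    unfolding E_def using m by (intro sum_imbalance_sq_le) simp
  have "real (card ?F) * c = (\<Sum>x\<in>?F. c)" by simp
  also have "\<dots> \<le> (\<Sum>x\<in>?F. ?W x)" by (intro sum_mono) auto
  also have "\<dots> \<le> (\<Sum>x\<in>?T. ?W x)" using finite_durfee_data by (intro sum_mono2 sum_nonneg) auto
  also have "\<dots> = (\<Sum>j\<in>?J. (real (min (Suc j) k))\<^sup>2 * (\<Sum>x\<in>?T. (imbalance x j)\<^sup>2))"
    unfolding sum.swap[of _ _ ?T] power_mult_distrib sum_distrib_left ..
  also have "\<dots> \<le> (\<Sum>j\<in>{..<l} \<union> {m..<n}. (real (min (Suc j) k))\<^sup>2 * (\<Sum>x\<in>?T. (imbalance x j)\<^sup>2))"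
    by (intro sum_mono2 mult_nonneg_nonneg sum_nonneg) auto
  also have "\<dots> \<le> (\<Sum>j<l. (real (min (Suc j) k))\<^sup>2 * (\<Sum>x\<in>?T. (imbalance x j)\<^sup>2))
      + (\<Sum>j\<in>{m..<n}. (real (min (Suc j) k))\<^sup>2 * (\<Sum>x\<in>?T. (imbalance x j)\<^sup>2))"
  proof -
    have "l \<le> m" using R by (simp add: m_def)
    then show ?thesis by (subst sum.union_disjoint) auto
  qed
  also have "\<dots> \<le> (\<Sum>j<l. E) + (\<Sum>j\<in>{m..<n}. (real k)\<^sup>2 * E * (1 / (real (Suc j))\<^sup>2))"
  proof (intro add_mono sum_mono)
    fix j
    have "(real (min (Suc j) k))\<^sup>2 * (\<Sum>x\<in>?T. (imbalance x j)\<^sup>2) \<le> (real (Suc j))\<^sup>2 * (\<Sum>x\<in>?T. (imbalance x j)\<^sup>2)"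
      by (intro mult_right_mono power_mono sum_nonneg) auto
    then show "(real (min (Suc j) k))\<^sup>2 * (\<Sum>x\<in>?T. (imbalance x j)\<^sup>2) \<le> E" using E[of j] by linarith
    have "(real (min (Suc j) k))\<^sup>2 * (\<Sum>x\<in>?T. (imbalance x j)\<^sup>2) \<le> (real k)\<^sup>2 * (E / (real (Suc j))\<^sup>2)"
    proof (intro mult_mono power_mono sum_nonneg)
      show "(\<Sum>x\<in>?T. (imbalance x j)\<^sup>2) \<le> E / (real (Suc j))\<^sup>2"
        using E[of j] by (simp only: pos_le_divide_eq zero_less_power of_nat_0_less_iff zero_less_Suc mult_ac)
    qed auto
    then show "(real (min (Suc j) k))\<^sup>2 * (\<Sum>x\<in>?T. (imbalance x j)\<^sup>2) \<le> (real k)\<^sup>2 * E * (1 / (real (Suc j))\<^sup>2)"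
      by simp
  qed
  also have "\<dots> = real l * E + (real k)\<^sup>2 * E * (\<Sum>j\<in>{m..<n}. 1 / (real (Suc j))\<^sup>2)"
    by (simp only: sum_distrib_left[symmetric] sum_constant card_lessThan)
  also have "\<dots> \<le> real l * E + (real k)\<^sup>2 * E * (1 / real m)"
  proof (intro add_left_mono mult_left_mono)
    have "0 \<le> 1 / real n" by simp
    then show "(\<Sum>j\<in>{m..<n}. 1 / (real (Suc j))\<^sup>2) \<le> 1 / real m"
      using sum_inverse_squares_le[OF m] by linarith
  qed (use \<open>0 \<le> E\<close> in simp)
  also have "(real k)\<^sup>2 * E * (1 / real m) = real l * E"
    using l R by (simp add: k_def m_def power2_eq_square field_simps)
  finally have "real (card ?F) * c \<le> 2560 * real n * real l * pnum n" by (simp add: E_def mult_ac)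
  then have "real (card ?F) \<le> 2560 * real n * real l / c * pnum n" using c by (simp add: field_simps)
  then show ?thesis by (simp add: k_def m_def)
qed

text \<open>
  The difference of the \<open>k\<close>-th partial sums of a partition and its conjugate, for \<open>k\<close> up to the
  side of the Durfee square (\<open>prefix_imbalance_glue\<close>).
\<close>

definition prefix_imbalance :: "nat \<Rightarrow> nat \<times> (nat \<Rightarrow> nat) \<times> (nat \<Rightarrow> nat) \<Rightarrow> real" where
  "prefix_imbalance k x = (\<Sum>j<square_side x. real (min (Suc j) k) * imbalance x j)"

lemma prefix_imbalance_flip:
  assumes "x \<in> durfee_data n"
  shows "prefix_imbalance k (flip A x) = signed_sum (\<lambda>j. real (min (Suc j) k) * imbalance x j) {..<n} A"
  unfolding prefix_imbalance_def signed_sum_def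
  using square_side_le[OF assms] imbalance_beyond_square[OF assms]
  by (intro sum.mono_neutral_cong_left) auto

text \<open>
  Since every flip permutes the partitions in \<open>G\<close>, the fraction of those with property \<open>P\<close> is the
  average, over the partitions in \<open>G\<close>, of the fraction of flips that produce \<open>P\<close>.
\<close>

lemma flip_average:
  assumes J: "finite J" and G: "\<And>A x. x \<in> durfee_data n \<Longrightarrow> G (flip A x) = G x" and c: "0 \<le> c"
    and avg: "\<And>x. x \<in> durfee_data n \<Longrightarrow> G x \<Longrightarrow> real (card {A \<in> Pow J. P (flip A x)}) \<le> c * 2 ^ card J"
  shows "real (card {x \<in> durfee_data n. G x \<and> P x}) \<le> c * pnum n"
proof -
  let ?T = "{x \<in> durfee_data n. G x}"
  have fin: "finite ?T" using finite_durfee_data by simp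
  have "card {x \<in> ?T. P (flip A x)} = card {x \<in> durfee_data n. G x \<and> P x}" for A
    by (rule bij_betw_same_card[of "flip A"], rule bij_betw_byWitness[where f' = "flip A"])
       (auto simp: G flip_durfee_data)
  then have "2 ^ card J * real (card {x \<in> durfee_data n. G x \<and> P x}) = (\<Sum>A\<in>Pow J. real (card {x \<in> ?T. P (flip A x)}))"
    using J by (simp add: card_Pow)
  also have "\<dots> = (\<Sum>x\<in>?T. real (card {A \<in> Pow J. P (flip A x)}))"
    by (rule sum_card_swap) (use fin J in auto)
  also have "\<dots> \<le> (\<Sum>x\<in>?T. c * 2 ^ card J)" by (intro sum_mono avg) auto
  also have "\<dots> = 2 ^ card J * (c * real (card ?T))" by simp
  also have "\<dots> \<le> 2 ^ card J * (c * pnum n)"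
    unfolding card_durfee_data[symmetric] using finite_durfee_data c
    by (intro mult_left_mono of_nat_mono card_mono) auto
  finally show ?thesis by (rule mult_left_le_imp_le) simp
qed

section \<open>Few partitions dominate their conjugate\<close>

text \<open>
  The choice of constants: first the number \<open>r\<close> of blocks, then the tolerances \<open>eta\<close> and
  \<open>th\<close>, then the ratio \<open>R\<close> of the blocks, and finally \<open>n\<close>. The \<open>i\<close>-th block starts at \<open>l i = R\<^sup>2\<^sup>i\<close>
  and belongs to \<open>k = l i * R\<close>; all blocks lie below \<open>K = R\<^sup>2\<^sup>r\<close>. A partition is good (\<open>G\<close>) if its square
  has side more than \<open>K\<close> and in each block the variance dominates. This depends only on the side
  and on the squares of the imbalances, so it is invariant under flips.
\<close>

lemma prefix_imbalance_rarely_nonneg: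
  assumes e: "0 < e"
  shows "\<exists>n0. \<forall>n\<ge>n0. real (card {x \<in> durfee_data n. \<forall>k\<le>square_side x. 0 \<le> prefix_imbalance k x}) \<le> e * pnum n"
proof -
  obtain r where r: "(29 / 32 :: real) ^ r < e / 6"
    using real_arch_pow_inv[of "e / 6" "29 / 32"] e by auto
  define eta where "eta = e / (24 * (real r + 1))"
  have eta: "0 < eta" using e by (simp add: eta_def)
  have r_eta: "4 * real r * eta \<le> e / 6" unfolding eta_def using e by (simp add: field_simps)
  obtain th where th: "0 < th" and rare: "\<And>K. \<exists>n0. \<forall>n\<ge>n0. \<forall>j<K.
       real (card {x \<in> durfee_data n. real (Suc j) * \<bar>imbalance x j\<bar> < th * sqrt (real n)}) \<le> eta * pnum n"
    using small_imbalance_rare[OF eta] by blast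
  define R where "R = 2 + nat \<lceil>61440 * real r / (eta * th\<^sup>2 * e)\<rceil>"
  have R: "2 \<le> R" by (simp add: R_def)
  have "61440 * real r / (eta * th\<^sup>2 * e) \<le> real R" unfolding R_def by linarith
  then have R_large: "real r * (10240 / (real R * eta * th\<^sup>2)) \<le> e / 6"
    using eta th e R by (simp add: field_simps)
  define K where "K = R ^ (2 * r)"
  obtain n1 where n1: "\<And>n j. n1 \<le> n \<Longrightarrow> j < K \<Longrightarrow>
       real (card {x \<in> durfee_data n. real (Suc j) * \<bar>imbalance x j\<bar> < th * sqrt (real n)}) \<le> eta * pnum n"
    using rare[of K] by blast
  define C where "C = 15384 * real K / e"
  define n0 where "n0 = n1 + 2 * (K * K) + 1 + nat \<lceil>C\<^sup>2\<rceil>"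
  define l where "l i = R ^ (2 * i)" for i
  have l: "0 < l i" for i using R by (simp add: l_def)
  have l_Suc: "l (Suc i) = l i * R * R" for i by (simp add: l_def)
  have l_mono: "l i \<le> l k" if "i \<le> k" for i k
    unfolding l_def using that R by (intro power_increasing) auto
  have l_K: "l i * R * R \<le> K" if "i < r" for i
    using l_mono[of "Suc i" r] that by (simp add: l_Suc) (simp add: l_def K_def)
  have k_K: "l i * R \<le> K" if "i < r" for i
  proof -
    have "l i * R * 1 \<le> l i * R * R" using R by (intro mult_le_mono2) simp
    then show ?thesis using l_K[OF that] by linarith
  qed
  show ?thesis
  proof (intro exI allI impI)
    fix n assume n: "n0 \<le> n"
    have n_pos: "0 < n" and n1n: "n1 \<le> n" and nK: "2 * (K * K) \<le> n" and Cn: "nat \<lceil>C\<^sup>2\<rceil> \<le> n"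
      using n unfolding n0_def by linarith+
    have "K \<le> K * K" by (cases K) auto
    then have Kn: "K \<le> n" using nK by linarith
    let ?T = "durfee_data n"
    define w where "w = (\<lambda>i x j. real (min (Suc j) (l i * R)) * imbalance x j)"
    define B where "B i = {l i..<l i * R * R}" for i
    define V where "V i x = (\<Sum>j\<in>B i. (w i x j)\<^sup>2)" for i x
    define W where "W i x = (\<Sum>j\<in>{..<n} - B i. (w i x j)\<^sup>2)" for i x
    define c where "c i = real (l i * R) * (th\<^sup>2 * real n) / 4" for i
    have c: "0 < c i" for i using l[of i] R th n_pos by (simp add: c_def)
    define G where "G x \<longleftrightarrow> K < square_side x \<and> (\<forall>i<r. c i \<le> V i x \<and> W i x \<le> eta * c i)" for x
    define P where "P x \<longleftrightarrow> (\<forall>k\<le>square_side x. 0 \<le> prefix_imbalance k x)" for x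
    let ?S = "{x \<in> ?T. square_side x \<le> K}"
    let ?V = "\<lambda>i. {x \<in> ?T. V i x < c i}"
    let ?W = "\<lambda>i. {x \<in> ?T. eta * c i < W i x}"

    have "real (card ?S) \<le> e / 6 * pnum n"
    proof -
      have "C\<^sup>2 \<le> real (nat \<lceil>C\<^sup>2\<rceil>)" by linarith
      also have "\<dots> \<le> real n" using Cn by (rule of_nat_mono)
      finally have "C \<le> sqrt (real n)" by (rule real_le_rsqrt)
      then have "2564 * real K / sqrt (real n) \<le> e / 6"
        using e n_pos unfolding C_def by (simp add: field_simps)
      then have "2564 * real K / sqrt (real n) * pnum n \<le> e / 6 * pnum n"
        by (rule mult_right_mono) simp
      then show ?thesis using small_square_rare[OF nK n_pos] by linarith
    qed
    moreover have "(\<Sum>i<r. real (card (?V i)) + real (card (?W i)))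
        \<le> (\<Sum>i<r. 4 * eta * pnum n + 10240 / (real R * eta * th\<^sup>2) * pnum n)"
    proof (intro sum_mono add_mono)
      fix i assume "i \<in> {..<r}"
      then have i: "i < r" by simp
      show "real (card (?V i)) \<le> 4 * eta * pnum n"
        unfolding V_def B_def w_def c_def
      proof (rule block_variance_rarely_small[OF l R th])
        fix j assume "j < l i * R"
        then have "j < K" using k_K[OF i] by linarith
        then show "real (card {x \<in> ?T. real (Suc j) * \<bar>imbalance x j\<bar> < th * sqrt (real n)}) \<le> eta * pnum n"
          by (rule n1[OF n1n])
      qed
      have "real (card (?W i)) \<le> 2560 * real n * real (l i) / (eta * c i) * pnum n"
        unfolding W_def B_def w_def
      proof (rule off_block_variance_rarely_large[OF l])
        show "0 < R" using R by simp
        show "l i * R * R \<le> n" using l_K[OF i] Kn by linarith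
        show "0 < eta * c i" using eta c by simp
      qed
      also have "2560 * real n * real (l i) / (eta * c i) = 10240 / (real R * eta * th\<^sup>2)"
        using l[of i] R n_pos th eta by (simp add: c_def field_simps)
      finally show "real (card (?W i)) \<le> 10240 / (real R * eta * th\<^sup>2) * pnum n" .
    qed
    moreover have "(\<Sum>i<r. 4 * eta * pnum n + 10240 / (real R * eta * th\<^sup>2) * pnum n)
        \<le> (e / 6 + e / 6) * pnum n"
    proof -
      have "(\<Sum>i<r. 4 * eta * pnum n + 10240 / (real R * eta * th\<^sup>2) * pnum n)
          = (4 * real r * eta + real r * (10240 / (real R * eta * th\<^sup>2))) * pnum n"
        by (simp add: algebra_simps)
      also have "\<dots> \<le> (e / 6 + e / 6) * pnum n"
        using r_eta R_large by (intro mult_right_mono add_mono) auto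
      finally show ?thesis .
    qed
    moreover have "real (card {x \<in> ?T. \<not> G x}) \<le> real (card ?S) + (\<Sum>i<r. real (card (?V i)) + real (card (?W i)))"
    proof -
      have "{x \<in> ?T. \<not> G x} \<subseteq> ?S \<union> (\<Union>i<r. ?V i \<union> ?W i)"
        unfolding G_def by (auto simp: not_le not_less)
      then have "card {x \<in> ?T. \<not> G x} \<le> card (?S \<union> (\<Union>i<r. ?V i \<union> ?W i))"
        using finite_durfee_data by (intro card_mono) auto
      also have "\<dots> \<le> card ?S + card (\<Union>i<r. ?V i \<union> ?W i)" by (rule card_Un_le)
      also have "card (\<Union>i<r. ?V i \<union> ?W i) \<le> (\<Sum>i<r. card (?V i \<union> ?W i))" by (rule card_UN_le) simp
      also have "\<dots> \<le> (\<Sum>i<r. card (?V i) + card (?W i))" by (intro sum_mono card_Un_le)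
      finally have "card {x \<in> ?T. \<not> G x} \<le> card ?S + (\<Sum>i<r. card (?V i) + card (?W i))" by simp
      from of_nat_mono[OF this, where 'a = real] show ?thesis by (simp only: of_nat_add of_nat_sum)
    qed
    moreover have "real (card {x \<in> ?T. G x \<and> P x}) \<le> ((29 / 32) ^ r + 4 * real r * eta) * pnum n"
    proof (rule flip_average[of "{..<n}"])
      show "G (flip A x) = G x" for A x
      proof -
        have "(w i (flip A x) j)\<^sup>2 = (w i x j)\<^sup>2" for i j by (simp add: w_def)
        then show ?thesis by (simp add: G_def V_def W_def)
      qed
      fix x assume x: "x \<in> ?T" "G x"
      have "{A \<in> Pow {..<n}. P (flip A x)} \<subseteq> {A \<in> Pow {..<n}. \<forall>i<r. 0 \<le> signed_sum (w i x) {..<n} A}"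
      proof -
        have "0 \<le> signed_sum (w i x) {..<n} A" if "P (flip A x)" "i < r" for A i
        proof -
          have "l i * R \<le> square_side (flip A x)"
            using k_K[OF that(2)] x(2) by (simp add: G_def)
          then have "0 \<le> prefix_imbalance (l i * R) (flip A x)" using that(1) unfolding P_def by blast
          then show ?thesis unfolding prefix_imbalance_flip[OF x(1)] w_def .
        qed
        then show ?thesis by blast
      qed
      then have "real (card {A \<in> Pow {..<n}. P (flip A x)})
          \<le> real (card {A \<in> Pow {..<n}. \<forall>i<r. 0 \<le> signed_sum (w i x) {..<n} A})"
        by (intro of_nat_mono card_mono) auto
      also have "\<dots> \<le> ((29 / 32) ^ r + 4 * real r * eta) * 2 ^ card {..<n}"
      proof (rule signed_sums_rarely_all_nonneg[where B = B])
        show "B i \<subseteq> {..<n}" if "i < r" for i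
          using l_K[OF that] Kn by (auto simp: B_def)
        show "B i \<inter> B k = {}" if "i < k" "k < r" for i k
          using l_mono[of "Suc i" k] that by (auto simp: B_def l_Suc)
        show "0 < (\<Sum>j\<in>B i. (w i x j)\<^sup>2)" if "i < r" for i
          using x(2) that c[of i] unfolding G_def V_def by (meson less_le_trans)
        show "(\<Sum>j\<in>{..<n} - B i. (w i x j)\<^sup>2) \<le> eta * (\<Sum>j\<in>B i. (w i x j)\<^sup>2)" if "i < r" for i
        proof -
          have "W i x \<le> eta * c i" "c i \<le> V i x" using x(2) that unfolding G_def by auto
          then have "W i x \<le> eta * V i x" using eta by (meson less_imp_le mult_left_mono order_trans)
          then show ?thesis by (simp add: V_def W_def)
        qed
      qed simp
      finally show "real (card {A \<in> Pow {..<n}. P (flip A x)})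
          \<le> ((29 / 32) ^ r + 4 * real r * eta) * 2 ^ card {..<n}" .
    qed (use eta in auto)
    moreover have "((29 / 32) ^ r + 4 * real r * eta) * pnum n \<le> (e / 6 + e / 6) * pnum n"
      using r r_eta by (intro mult_right_mono add_mono) auto
    moreover have "real (card {x \<in> ?T. P x}) \<le> real (card {x \<in> ?T. \<not> G x}) + real (card {x \<in> ?T. G x \<and> P x})"
    proof -
      have "card {x \<in> ?T. P x} \<le> card ({x \<in> ?T. \<not> G x} \<union> {x \<in> ?T. G x \<and> P x})"
        using finite_durfee_data by (intro card_mono) auto
      also have "\<dots> \<le> card {x \<in> ?T. \<not> G x} + card {x \<in> ?T. G x \<and> P x}" by (rule card_Un_le)
      finally show ?thesis by (simp flip: of_nat_add)
    qed
    moreover have "0 \<le> e * pnum n" using e by simp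
    ultimately have "real (card {x \<in> ?T. P x}) \<le> e * pnum n"
      by (simp only: distrib_right times_divide_eq_left)
    then show "real (card {x \<in> ?T. \<forall>k\<le>square_side x. 0 \<le> prefix_imbalance k x}) \<le> e * pnum n"
      by (simp add: P_def)
  qed
qed

lemma prefix_imbalance_glue:
  assumes "k \<le> square_side x"
  shows "prefix_imbalance k x
    = real (\<Sum>i<k. glue x i) - real (\<Sum>i<k. conjugate_partition (glue x) i)"
proof -
  obtain D a b where x: "x = (D, a, b)" by (cases x)
  have k: "k \<le> D" using assms by (simp add: x)
  have "(\<Sum>i<k. glue x i) = (\<Sum>i<k. arm D a i)"
    using k by (intro sum.cong) (auto simp: x glue_def)
  moreover have "(\<Sum>i<k. conjugate_partition (glue x) i) = (\<Sum>i<k. arm D b i)"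
    using k by (intro sum.cong) (auto simp: x conjugate_glue)
  ultimately show ?thesis
    unfolding sum_arm[OF k]
    by (simp add: prefix_imbalance_def imbalance_def x right_diff_distrib sum_subtractf)
qed

text \<open>
  Flipping every index exchanges the partitions that dominate their conjugate with those that are
  dominated by it.
\<close>

lemma card_comparable_le:
  assumes "lam \<in> partitions_of n" "self_conjugate lam"
  shows "card (comparable_partitions n lam)
    \<le> 2 * card {x \<in> durfee_data n. \<forall>k\<le>square_side x. 0 \<le> prefix_imbalance k x}"
proof -
  let ?U = "{x \<in> durfee_data n. \<forall>k\<le>square_side x. 0 \<le> prefix_imbalance k x}"
  let ?L = "{x \<in> durfee_data n. \<forall>k\<le>square_side x. prefix_imbalance k x \<le> 0}"
  have neg: "prefix_imbalance k (flip UNIV x) = - prefix_imbalance k x" for k x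
    by (simp add: prefix_imbalance_def sum_negf)
  have "card ?L = card ?U"
    by (rule bij_betw_same_card[of "flip UNIV"], rule bij_betw_byWitness[where f' = "flip UNIV"])
       (auto simp: neg flip_durfee_data)
  have "comparable_partitions n lam \<subseteq> glue ` (?U \<union> ?L)"
  proof
    fix q assume "q \<in> comparable_partitions n lam"
    then have q: "q \<in> partitions_of n" "dominance_comparable lam q"
      by (auto simp: comparable_partitions_def)
    obtain x where x: "x \<in> durfee_data n" "q = glue x" using partition_in_glue_image[OF q(1)] by blast
    have "x \<in> ?U \<union> ?L"
      using comparable_self_conjugate[OF assms q]
    proof
      assume "dominates q (conjugate_partition q)"
      then have "(\<Sum>i<k. conjugate_partition (glue x) i) \<le> (\<Sum>i<k. glue x i)" for k
        unfolding dominates_def x(2) by blast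
      from of_nat_mono[OF this, where 'a = real] have "x \<in> ?U"
        using x(1) by (auto simp: prefix_imbalance_glue simp del: of_nat_sum)
      then show ?thesis by blast
    next
      assume "dominates (conjugate_partition q) q"
      then have "(\<Sum>i<k. glue x i) \<le> (\<Sum>i<k. conjugate_partition (glue x) i)" for k
        unfolding dominates_def x(2) by blast
      from of_nat_mono[OF this, where 'a = real] have "x \<in> ?L"
        using x(1) by (auto simp: prefix_imbalance_glue simp del: of_nat_sum)
      then show ?thesis by blast
    qed
    then show "q \<in> glue ` (?U \<union> ?L)" using x(2) by blast
  qed
  then have "card (comparable_partitions n lam) \<le> card (glue ` (?U \<union> ?L))"
    using finite_durfee_data by (intro card_mono) auto
  also have "\<dots> \<le> card (?U \<union> ?L)" using finite_durfee_data by (intro card_image_le) auto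
  also have "\<dots> \<le> card ?U + card ?L" by (rule card_Un_le)
  finally show ?thesis using \<open>card ?L = card ?U\<close> by simp
qed

lemma comparable_fraction_small:
  assumes "0 < e"
  obtains n0 where "\<And>n lam. n0 \<le> n \<Longrightarrow> lam \<in> partitions_of n \<Longrightarrow> self_conjugate lam \<Longrightarrow>
    real (card (comparable_partitions n lam)) / pnum n < e"
proof -
  obtain n0 where n0: "\<And>n. n0 \<le> n \<Longrightarrow>
      real (card {x \<in> durfee_data n. \<forall>k\<le>square_side x. 0 \<le> prefix_imbalance k x}) \<le> e / 4 * pnum n"
    using prefix_imbalance_rarely_nonneg[of "e / 4"] assms by auto
  show thesis
  proof (rule that)
    fix n lam assume n: "n0 \<le> n" and lam: "lam \<in> partitions_of n" "self_conjugate lam"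
    have pos: "0 < pnum n" using lam(1) finite_partitions_of[of n] by (auto simp: card_gt_0_iff)
    have "real (card (comparable_partitions n lam))
        \<le> 2 * real (card {x \<in> durfee_data n. \<forall>k\<le>square_side x. 0 \<le> prefix_imbalance k x})"
      using of_nat_mono[OF card_comparable_le[OF lam], where 'a = real] by simp
    also have "\<dots> \<le> e / 2 * pnum n" using n0[OF n] by linarith
    finally have "real (card (comparable_partitions n lam)) / pnum n \<le> e / 2"
      using pos by (simp add: field_simps)
    then show "real (card (comparable_partitions n lam)) / pnum n < e" using assms by linarith
  qed
qed

theorem corollary3p3:
  shows "(\<forall>lam :: nat \<Rightarrow> nat \<Rightarrow> nat.
            (\<forall>n. (\<exists>p \<in> partitions_of n. self_conjugate p) \<longrightarrow>
                 lam n \<in> partitions_of n \<and> self_conjugate (lam n)) \<longrightarrow>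
            ((\<lambda>n. real (card (comparable_partitions n (lam n))) / real (card (partitions_of n)))
               \<longlongrightarrow> 0)
              (inf sequentially (principal {n. \<exists>p \<in> partitions_of n. self_conjugate p})))
         \<and> (\<lambda>m. real (card (comparable_partitions (m * (m + 1) div 2) (staircase m)))
                  / real (card (partitions_of (m * (m + 1) div 2))))
             \<longlonglongrightarrow> 0"
proof (intro conjI allI impI)
  fix lam :: "nat \<Rightarrow> nat \<Rightarrow> nat"
  let ?N = "{n. \<exists>p \<in> partitions_of n. self_conjugate p}"
  assume lam: "\<forall>n. (\<exists>p \<in> partitions_of n. self_conjugate p) \<longrightarrow>
      lam n \<in> partitions_of n \<and> self_conjugate (lam n)"
  show "((\<lambda>n. real (card (comparable_partitions n (lam n))) / pnum n) \<longlongrightarrow> 0) (inf sequentially (principal ?N))"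
  proof (rule tendstoI)
    fix e :: real assume "0 < e"
    then obtain n0 where n0: "\<And>n lam. n0 \<le> n \<Longrightarrow> lam \<in> partitions_of n \<Longrightarrow> self_conjugate lam \<Longrightarrow>
        real (card (comparable_partitions n lam)) / pnum n < e"
      using comparable_fraction_small by blast
    show "\<forall>\<^sub>F n in inf sequentially (principal ?N).
        dist (real (card (comparable_partitions n (lam n))) / pnum n) 0 < e"
      unfolding eventually_inf_principal eventually_sequentially
    proof (intro exI[of _ n0] allI impI)
      fix n assume "n0 \<le> n" "n \<in> ?N"
      then show "dist (real (card (comparable_partitions n (lam n))) / pnum n) 0 < e"
        using n0[of n "lam n"] lam by (simp add: dist_real_def)
    qed
  qed
next
  show "(\<lambda>m. real (card (comparable_partitions (m * (m + 1) div 2) (staircase m)))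
      / pnum (m * (m + 1) div 2)) \<longlonglongrightarrow> 0"
  proof (rule LIMSEQ_I)
    fix e :: real assume "0 < e"
    then obtain n0 where n0: "\<And>n lam. n0 \<le> n \<Longrightarrow> lam \<in> partitions_of n \<Longrightarrow> self_conjugate lam \<Longrightarrow>
        real (card (comparable_partitions n lam)) / pnum n < e"
      using comparable_fraction_small by blast
    show "\<exists>m0. \<forall>m\<ge>m0. norm (real (card (comparable_partitions (m * (m + 1) div 2) (staircase m)))
        / pnum (m * (m + 1) div 2) - 0) < e"
    proof (intro exI[of _ n0] allI impI)
      fix m assume m: "n0 \<le> m"
      have "m * 2 \<le> m * (m + 1)" by (cases m) auto
      then have "n0 \<le> m * (m + 1) div 2" using m by linarith
      from n0[OF this staircase_partition staircase_self_conjugate]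
      show "norm (real (card (comparable_partitions (m * (m + 1) div 2) (staircase m)))
          / pnum (m * (m + 1) div 2) - 0) < e" by simp
    qed
  qed
qed

end
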